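(* Let $f:\mathbb{R}^d\to\mathbb{R}^d$ be Lipschitz continuous. For integers $1\le m\le n$ let $$Q=f(X^n_T)-f(X^m_T)+M_m,\qquad M_m=\mathbb{E}f(X^m_T),$$ where $X^n$ and $X^m$ are driven by the same Brownian motion. Then $$\sigma_Q^2:=\mathrm{Var}(Q)=O(1/m),$$ i.e. there is a constant $K$ not depending on $m,n$ such that $\mathrm{Var}(Q)\le K/m$ for all $1\le m\le n$.
   Context: $T>0$; $W$ is a $q$-dimensional Brownian motion on a filtered probability space $(\Omega,\mathcal{F},(\mathcal{F}_t)_{t\ge0},P)$, with $(\mathcal{F}_t)$ the standard Brownian filtration. $(X_t)_{0\le t\le T}$ is the $\mathbb{R}^d$-valued solution of $dX_t=b(X_t)\,dt+\sigma(X_t)\,dW_t$, $X_0=x\in\mathbb{R}^d$, where $b:\mathbb{R}^d\to\mathbb{R}^d$ and $\sigma:\mathbb{R}^d\to\mathbb{R}^{d\times q}$ are continuously differentiable and globally Lipschitz. $X^n$ is the continuous Euler approximation with step $\delta=T/n$: $dX^n_t=b(X^n_{\eta_n(t)})\,dt+\sigma(X^n_{\eta_n(t)})\,dW_t$, $X^n_0=x$, $\eta_n(t)=[t/\delta]\delta$, with $[\cdot]$ the integer part; $X^m$ is the same with $m$ in place of $n$. $\mathrm{Var}(Q)=\mathbb{E}|Q-\mathbb{E}Q|^2$. *)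

theory Defs
  imports "HOL-Probability.Probability"
begin

definition continuously_differentiable ::
    "('a::real_normed_vector \<Rightarrow> 'b::real_normed_vector) \<Rightarrow> bool" where
  "continuously_differentiable g \<longleftrightarrow>
     (\<exists>g' :: 'a \<Rightarrow> 'a \<Rightarrow>\<^sub>L 'b.
        (\<forall>x. (g has_derivative blinfun_apply (g' x)) (at x)) \<and> continuous_on UNIV g')"

locale filtered_prob_space = prob_space M for M :: "'a measure" +
  fixes F :: "real \<Rightarrow> 'a measure"
  assumes subalgebra_F: "0 \<le> t \<Longrightarrow> subalgebra M (F t)"
    and F_mono: "0 \<le> s \<Longrightarrow> s \<le> t \<Longrightarrow> sets (F s) \<subseteq> sets (F t)"

(* Processes are indexed by the reals; only times t \<ge> 0 are constrained. *)
locale brownian_motion = filtered_prob_space M F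
  for M :: "'a measure" and F :: "real \<Rightarrow> 'a measure" +
  fixes W :: "real \<Rightarrow> 'a \<Rightarrow> real ^ 'q"
  assumes adapted: "0 \<le> t \<Longrightarrow> W t \<in> borel_measurable (F t)"
    and start: "AE \<omega> in M. W 0 \<omega> = 0"
    and continuous_paths: "AE \<omega> in M. continuous_on {0..} (\<lambda>t. W t \<omega>)"
    and increment_indep_past: "0 \<le> s \<Longrightarrow> s < t \<Longrightarrow>
          indep_set (sets (F s))
            {(\<lambda>\<omega>. W t \<omega> - W s \<omega>) -` A \<inter> space M | A. A \<in> sets borel}"
    and increment_components_indep: "0 \<le> s \<Longrightarrow> s < t \<Longrightarrow>
          indep_vars (\<lambda>_. borel) (\<lambda>i \<omega>. (W t \<omega> - W s \<omega>) $ i) UNIV"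
    and increment_normal: "0 \<le> s \<Longrightarrow> s < t \<Longrightarrow>
          distributed M lborel (\<lambda>\<omega>. (W t \<omega> - W s \<omega>) $ i)
            (\<lambda>y. ennreal (normal_density 0 (sqrt (t - s)) y))"

(* The natural filtration of W augmented by the null sets of M. If M is complete this is the usual
   augmentation; completeness is not built in. *)
definition brownian_filtration ::
    "'a measure \<Rightarrow> (real \<Rightarrow> 'a \<Rightarrow> real ^ 'q) \<Rightarrow> real \<Rightarrow> 'a measure" where
  "brownian_filtration M W t =
     sigma (space M)
       ({W s -` A \<inter> space M | s A. 0 \<le> s \<and> s \<le> t \<and> A \<in> sets borel} \<union> null_sets M)"

(* \<eta>_n(t) = [t / \<delta>] \<delta> with \<delta> = T / n *)
definition grid_floor :: "real \<Rightarrow> nat \<Rightarrow> real \<Rightarrow> real" where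
  "grid_floor T n t = of_int \<lfloor>t / (T / real n)\<rfloor> * (T / real n)"

(* The (elementary) Ito integral over [0,t] of an integrand that is constant on each interval
   [k \<delta>, (k+1) \<delta>), evaluated pathwise: h and w are the paths of integrand and integrator.
   The summation range consists of the k \<ge> 0 with k \<delta> < t. *)
definition step_ito_integral ::
    "real \<Rightarrow> (real \<Rightarrow> real ^ 'q ^ 'd) \<Rightarrow> (real \<Rightarrow> real ^ 'q) \<Rightarrow> real \<Rightarrow> real ^ 'd" where
  "step_ito_integral \<delta> h w t =
     (\<Sum>k<nat \<lceil>t / \<delta>\<rceil>.
        h (real k * \<delta>) *v (w (min (real (Suc k) * \<delta>) t) - w (real k * \<delta>)))"

(* dX_t = b(X_{\<eta>_n(t)}) dt + \<sigma>(X_{\<eta>_n(t)}) dW_t, X_0 = x, in integral form; this determines X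
   on [0,T] up to indistinguishability. *)
definition euler_approximation ::
    "'a measure \<Rightarrow> (real \<Rightarrow> 'a measure) \<Rightarrow> (real \<Rightarrow> 'a \<Rightarrow> real ^ 'q) \<Rightarrow>
     (real ^ 'd \<Rightarrow> real ^ 'd) \<Rightarrow> (real ^ 'd \<Rightarrow> real ^ 'q ^ 'd) \<Rightarrow> real ^ 'd \<Rightarrow> real \<Rightarrow> nat \<Rightarrow>
     (real \<Rightarrow> 'a \<Rightarrow> real ^ 'd) \<Rightarrow> bool" where
  "euler_approximation M F W b \<sigma> x T n X \<longleftrightarrow>
     (\<forall>t\<in>{0..T}. X t \<in> borel_measurable (F t)) \<and>
     (AE \<omega> in M. \<forall>t\<in>{0..T}.
        X t \<omega> = x + (LBINT s:{0..t}. b (X (grid_floor T n s) \<omega>))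
          + step_ito_integral (T / real n) (\<lambda>s. \<sigma> (X (grid_floor T n s) \<omega>)) (\<lambda>s. W s \<omega>) t)"

(* prob_space.variance is restricted to real-valued random variables. *)
definition Var :: "'a measure \<Rightarrow> ('a \<Rightarrow> real ^ 'd) \<Rightarrow> real" where
  "Var M Q = (\<integral>\<omega>. (norm (Q \<omega> - (\<integral>\<omega>'. Q \<omega>' \<partial>M)))\<^sup>2 \<partial>M)"

end

(* Both schemes are compared with the Euler scheme on the grid of n * m steps, which refines both
   of their grids, so that neither the solution of the SDE nor a comparison of incompatible grids is
   needed. Along the refined grid the error obeys a one-step recursion: the increment of W is
   independent of the past, so the noise is orthogonal to it and contributes its variance only. A
   discrete Gronwall argument turns the local errors of order 1/n and 1/m into mean square errors of
   the same order at time T. The variance of Q is at most the second moment of Q about M_m, which is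
   controlled by these errors since f is Lipschitz. *)
theory Submission
  imports Defs
begin

text \<open>The difficulty is uniformity: the refinement factor is as large as n or m, so the
  comparison of a scheme with its refinement must not deteriorate as that factor grows. It does not,
  because the Gronwall bound sees the number of steps only through the elapsed time, which is at
  most T, and because the error has a single source, the lag between a time and the last grid point
  of the coarse scheme. Over a lag of at most T / n the coarse scheme moves by a mean square amount
  of order 1 / n, since the variance of a Brownian increment is the elapsed time; this is where the
  rate comes from. On a cell of the refined grid both schemes have coefficients frozen at values
  known at its left end. The error is followed only along these grid points, so the Ito isometry
  reduces to independence of an increment from the past and the second moments of a normal
  law.\<close>

section \<open>Square integrable random vectors and matrices\<close>

lemma norm_vec_power2: "(norm (v :: 'a::real_normed_vector ^ 'n))\<^sup>2 = (\<Sum>i\<in>UNIV. (norm (v $ i))\<^sup>2)"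
  by (simp add: norm_vec_def L2_set_def sum_nonneg)

lemma borel_measurable_vec_nth [measurable (raw)]:
  fixes g :: "'a \<Rightarrow> 'b::topological_space ^ 'n"
  assumes "g \<in> borel_measurable N"
  shows "(\<lambda>\<omega>. g \<omega> $ i) \<in> borel_measurable N"
  by (rule measurable_compose[OF assms]) (intro borel_measurable_continuous_onI continuous_intros)

lemma borel_measurable_matrix_vector_mult [measurable (raw)]:
  fixes A :: "'a \<Rightarrow> real ^ 'q ^ 'd" and v :: "'a \<Rightarrow> real ^ 'q"
  assumes "A \<in> borel_measurable N" and "v \<in> borel_measurable N"
  shows "(\<lambda>\<omega>. A \<omega> *v v \<omega>) \<in> borel_measurable N"
  unfolding matrix_vector_mult_def using assms
  by (rule borel_measurable_continuous_Pair) (intro continuous_intros)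

text \<open>Measurability is part of the notion because integrability of the squared norm does not
  imply it.\<close>

definition square_integrable :: "'a measure \<Rightarrow> ('a \<Rightarrow> 'b::{second_countable_topology, banach}) \<Rightarrow> bool" where
  "square_integrable M g \<longleftrightarrow> g \<in> borel_measurable M \<and> integrable M (\<lambda>\<omega>. (norm (g \<omega>))\<^sup>2)"

lemma square_integrableI_bound:
  assumes "integrable M g" and [measurable]: "h \<in> borel_measurable M"
    and "AE \<omega> in M. (norm (h \<omega>))\<^sup>2 \<le> g \<omega>"
  shows "square_integrable M h"
proof -
  have "integrable M (\<lambda>\<omega>. (norm (h \<omega>))\<^sup>2)"
  proof (rule Bochner_Integration.integrable_bound[OF assms(1)])
    show "AE \<omega> in M. norm ((norm (h \<omega>))\<^sup>2) \<le> norm (g \<omega>)"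
      using assms(3) by eventually_elim simp
  qed measurable
  then show ?thesis by (simp add: square_integrable_def)
qed

lemma norm_add_power2_le: "(norm (a + b :: 'a::real_normed_vector))\<^sup>2 \<le> 2 * (norm a)\<^sup>2 + 2 * (norm b)\<^sup>2"
proof -
  have "(norm (a + b))\<^sup>2 \<le> (norm a + norm b)\<^sup>2"
    by (intro power_mono norm_triangle_ineq norm_ge_zero)
  also have "\<dots> \<le> 2 * (norm a)\<^sup>2 + 2 * (norm b)\<^sup>2"
    using sum_squares_bound[of "norm a" "norm b"] by (simp add: power2_sum)
  finally show ?thesis .
qed

lemma square_integrable_add:
  assumes "square_integrable M g" and "square_integrable M h"
  shows "square_integrable M (\<lambda>\<omega>. g \<omega> + h \<omega>)"
  using assms unfolding square_integrable_def
  by (intro square_integrableI_bound[unfolded square_integrable_def,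
        of _ "\<lambda>\<omega>. 2 * (norm (g \<omega>))\<^sup>2 + 2 * (norm (h \<omega>))\<^sup>2"])
    (auto simp: norm_add_power2_le)

lemma square_integrable_scaleR:
  assumes "square_integrable M g"
  shows "square_integrable M (\<lambda>\<omega>. c *\<^sub>R g \<omega>)"
  proof -
  have [measurable]: "g \<in> borel_measurable M"
    using assms by (simp add: square_integrable_def)
  have "(\<lambda>\<omega>. c *\<^sub>R g \<omega>) \<in> borel_measurable M" by measurable
  then show ?thesis using assms by (simp add: square_integrable_def power_mult_distrib)
qed

lemma square_integrable_diff:
  assumes "square_integrable M g" and "square_integrable M h"
  shows "square_integrable M (\<lambda>\<omega>. g \<omega> - h \<omega>)"
  using square_integrable_add[OF assms(1) square_integrable_scaleR[OF assms(2), of "-1"]] by simp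

lemma (in finite_measure) square_integrable_const: "square_integrable M (\<lambda>_. c)"
  by (simp add: square_integrable_def)

lemma square_integrable_vec_nth:
  fixes g :: "'a \<Rightarrow> 'b::euclidean_space ^ 'n"
  assumes "square_integrable M g"
  shows "square_integrable M (\<lambda>\<omega>. g \<omega> $ i)"
proof (rule square_integrableI_bound)
  have [measurable]: "g \<in> borel_measurable M"
    using assms by (simp add: square_integrable_def)
  show "integrable M (\<lambda>\<omega>. (norm (g \<omega>))\<^sup>2)"
    using assms by (simp add: square_integrable_def)
  show "(\<lambda>\<omega>. g \<omega> $ i) \<in> borel_measurable M" by measurable
qed (auto intro!: AE_I2 power_mono Finite_Cartesian_Product.norm_nth_le)

lemma integrable_mult_square_integrable:
  fixes g h :: "'a \<Rightarrow> real"
  assumes "square_integrable M g" and "square_integrable M h"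
  shows "integrable M (\<lambda>\<omega>. g \<omega> * h \<omega>)"
proof (rule Bochner_Integration.integrable_bound)
  have [measurable]: "g \<in> borel_measurable M" "h \<in> borel_measurable M"
    using assms by (simp_all add: square_integrable_def)
  show "integrable M (\<lambda>\<omega>. (g \<omega>)\<^sup>2 + (h \<omega>)\<^sup>2)"
    using assms by (simp add: square_integrable_def)
  show "AE \<omega> in M. norm (g \<omega> * h \<omega>) \<le> norm ((g \<omega>)\<^sup>2 + (h \<omega>)\<^sup>2)"
  proof (intro AE_I2)
    fix \<omega>
    have "2 * (\<bar>g \<omega>\<bar> * \<bar>h \<omega>\<bar>) \<le> (g \<omega>)\<^sup>2 + (h \<omega>)\<^sup>2"
      using sum_squares_bound[of "\<bar>g \<omega>\<bar>" "\<bar>h \<omega>\<bar>"] by simp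
    moreover have "0 \<le> \<bar>g \<omega>\<bar> * \<bar>h \<omega>\<bar>" by simp
    ultimately have "\<bar>g \<omega>\<bar> * \<bar>h \<omega>\<bar> \<le> (g \<omega>)\<^sup>2 + (h \<omega>)\<^sup>2" by linarith
    then show "norm (g \<omega> * h \<omega>) \<le> norm ((g \<omega>)\<^sup>2 + (h \<omega>)\<^sup>2)" by (simp add: abs_mult)
  qed
  show "(\<lambda>\<omega>. g \<omega> * h \<omega>) \<in> borel_measurable M" by measurable
qed

lemma (in finite_measure) square_integrable_imp_integrable:
  assumes "square_integrable M g"
  shows "integrable M g"
proof (rule Bochner_Integration.integrable_bound)
  show "integrable M (\<lambda>\<omega>. 1 + (norm (g \<omega>))\<^sup>2)" "g \<in> borel_measurable M"
    using assms by (simp_all add: square_integrable_def)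
  have "r \<le> 1 + r\<^sup>2" for r :: real
    using zero_le_power2[of "r - 1/2"] by (simp add: power2_diff power_divide)
  then show "AE \<omega> in M. norm (g \<omega>) \<le> norm (1 + (norm (g \<omega>))\<^sup>2)" by simp
qed

section \<open>Brownian increments and their independence from the past\<close>

context filtered_prob_space
begin

lemma space_F: "0 \<le> t \<Longrightarrow> space (F t) = space M"
  using subalgebra_F by (simp add: subalgebra_def)

lemma measurable_F_imp: "0 \<le> t \<Longrightarrow> g \<in> measurable (F t) N \<Longrightarrow> g \<in> measurable M N"
  using subalgebra_F measurable_from_subalg by blast

lemma measurable_F_mono:
  assumes "0 \<le> s" and "s \<le> t" and "g \<in> measurable (F s) N"
  shows "g \<in> measurable (F t) N"
proof -
  have "subalgebra (F t) (F s)"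
    using assms F_mono space_F by (simp add: subalgebra_def)
  then show ?thesis using assms(3) measurable_from_subalg by blast
qed

end

context brownian_motion
begin

lemma measurable_W: "0 \<le> t \<Longrightarrow> W t \<in> borel_measurable M"
  using adapted measurable_F_imp by blast

lemma increment_moments:
  assumes "0 \<le> s" and "s < t"
  shows "square_integrable M (\<lambda>\<omega>. (W t \<omega> - W s \<omega>) $ i)"
    and "(\<integral>\<omega>. (W t \<omega> - W s \<omega>) $ i \<partial>M) = 0"
    and "(\<integral>\<omega>. (W t \<omega> - W s \<omega>) $ i * (W t \<omega> - W s \<omega>) $ j \<partial>M) = (if i = j then t - s else 0)"
proof -
  have pos: "0 < sqrt (t - s)" using assms by simp
  have sq: "square_integrable M (\<lambda>\<omega>. (W t \<omega> - W s \<omega>) $ i)" for i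
  proof -
    note D = increment_normal[OF assms, of i]
    \<comment> \<open>The subtracted \<open>0\<close> is the mean of the normal law; moments of that
      law are stated as centred ones.\<close>
    have "integrable M (\<lambda>\<omega>. ((W t \<omega> - W s \<omega>) $ i - 0) ^ 2)"
      using distributed_integrable[OF D, of "\<lambda>y. (y - 0)\<^sup>2"] integrable_normal_moment[OF pos, of 0 2] by simp
    moreover have "(\<lambda>\<omega>. (W t \<omega> - W s \<omega>) $ i) \<in> borel_measurable M"
      using distributed_measurable[OF D] by simp
    ultimately show ?thesis by (simp add: square_integrable_def)
  qed
  then show "square_integrable M (\<lambda>\<omega>. (W t \<omega> - W s \<omega>) $ i)" .
  have mean: "(\<integral>\<omega>. (W t \<omega> - W s \<omega>) $ i \<partial>M) = 0" for i
    using normal_distributed_expectation[OF pos increment_normal[OF assms]] .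
  then show "(\<integral>\<omega>. (W t \<omega> - W s \<omega>) $ i \<partial>M) = 0" .
  show "(\<integral>\<omega>. (W t \<omega> - W s \<omega>) $ i * (W t \<omega> - W s \<omega>) $ j \<partial>M) = (if i = j then t - s else 0)"
  proof (cases "i = j")
    case True
    have "variance (\<lambda>\<omega>. (W t \<omega> - W s \<omega>) $ i) = (sqrt (t - s))\<^sup>2"
      by (rule normal_distributed_variance[OF pos increment_normal[OF assms]])
    with True mean[of i] assms show ?thesis by (simp add: power2_eq_square)
  next
    case False
    \<comment> \<open>Independence of two components turns the mixed moment into a product of means,
      and both means are 0.\<close>
    have "indep_vars (\<lambda>_. borel) (\<lambda>i \<omega>. (W t \<omega> - W s \<omega>) $ i) {i, j}"
      by (rule indep_vars_subset[OF increment_components_indep[OF assms]]) simp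
    from indep_vars_lebesgue_integral[OF _ this square_integrable_imp_integrable[OF sq]] False
    have "(\<integral>\<omega>. (W t \<omega> - W s \<omega>) $ i * (W t \<omega> - W s \<omega>) $ j \<partial>M)
        = (\<integral>\<omega>. (W t \<omega> - W s \<omega>) $ i \<partial>M) * (\<integral>\<omega>. (W t \<omega> - W s \<omega>) $ j \<partial>M)"
      by simp
    with False mean show ?thesis by simp
  qed
qed

lemma measurable_increment:
  assumes "0 \<le> s" and "0 \<le> t"
  shows "(\<lambda>\<omega>. W t \<omega> - W s \<omega>) \<in> borel_measurable M"
  using assms measurable_W by (intro borel_measurable_diff) auto

text \<open>Independence is inherited by smaller families: the sigma-algebra of \<open>U\<close>
  lies in \<open>F s\<close>, and that of the transformed increment lies in the sigma-algebra of the
  increment. The function \<open>g\<close> makes the lemma apply to single coordinates of the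
  increment as well as to products of two of them.\<close>

lemma indep_past_increment:
  fixes U :: "'a \<Rightarrow> 'b::topological_space"
  assumes st: "0 \<le> s" "s < t" and U: "U \<in> borel_measurable (F s)"
    and g: "g \<in> borel_measurable borel"
  shows "indep_var borel U borel (\<lambda>\<omega>. g (W t \<omega> - W s \<omega>))"
  unfolding indep_var_eq
proof (intro conjI)
  let ?D = "\<lambda>\<omega>. W t \<omega> - W s \<omega>"
  show "random_variable borel U" using st U measurable_F_imp by blast
  have D: "random_variable borel ?D"
    using measurable_increment[of s t] st by simp
  show "random_variable borel (\<lambda>\<omega>. g (?D \<omega>))"
    by (rule measurable_compose[OF D g])
  have "sigma_sets (space (F s)) {U -` A \<inter> space (F s) |A. A \<in> sets borel} \<subseteq> sets (F s)"
    using U by (intro sets.sigma_sets_subset) (auto intro: measurable_sets)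
  then have past: "sigma_sets (space M) {U -` A \<inter> space M |A. A \<in> sets borel} \<subseteq> sets (F s)"
    using space_F[OF st(1)] by simp
  \<comment> \<open>The preimages of Borel sets under \<open>?D\<close> already form a
    sigma-algebra, so the family in \<open>increment_indep_past\<close> contains everything
    generated by \<open>?D\<close>.\<close>
  have "?D \<in> measurable (vimage_algebra (space M) ?D borel) borel"
    by (rule measurable_vimage_algebra1) simp
  then have "(\<lambda>\<omega>. g (?D \<omega>)) \<in> borel_measurable (vimage_algebra (space M) ?D borel)"
    using g by (rule measurable_compose)
  from measurable_sets[OF this]
  have "sigma_sets (space M) {(\<lambda>\<omega>. g (?D \<omega>)) -` A \<inter> space M |A. A \<in> sets borel}
      \<subseteq> sets (vimage_algebra (space M) ?D borel)"
    using sets.sigma_sets_subset[of "{(\<lambda>\<omega>. g (?D \<omega>)) -` A \<inter> space M |A. A \<in> sets borel}"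
        "vimage_algebra (space M) ?D borel"] by auto
  also have "\<dots> = {?D -` A \<inter> space M |A. A \<in> sets borel}"
    by (rule sets_vimage_algebra2) simp
  finally show "indep_set (sigma_sets (space M) {U -` A \<inter> space M |A. A \<in> sets borel})
      (sigma_sets (space M) {(\<lambda>\<omega>. g (?D \<omega>)) -` A \<inter> space M |A. A \<in> sets borel})"
    using increment_indep_past[OF st] past unfolding indep_set_def
    by (elim indep_sets_mono_sets) (auto split: bool.splits)
qed

lemma past_times_increment:
  fixes U :: "'a \<Rightarrow> real"
  assumes "0 \<le> s" "s < t" and "U \<in> borel_measurable (F s)" and "integrable M U"
    and "g \<in> borel_measurable borel" and "integrable M (\<lambda>\<omega>. g (W t \<omega> - W s \<omega>))"
  shows "integrable M (\<lambda>\<omega>. U \<omega> * g (W t \<omega> - W s \<omega>))"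
    and "(\<integral>\<omega>. U \<omega> * g (W t \<omega> - W s \<omega>) \<partial>M) = (\<integral>\<omega>. U \<omega> \<partial>M) * (\<integral>\<omega>. g (W t \<omega> - W s \<omega>) \<partial>M)"
  using indep_past_increment[OF assms(1,2,3,5)] assms(4,6)
  by (rule indep_var_integrable indep_var_lebesgue_integral)+

text \<open>This is the Ito isometry for one row of a frozen integrand. After expanding the square,
  the term linear in the increment has mean zero, and of the quadratic terms only the diagonal ones
  survive, each with the variance \<open>t - s\<close>.\<close>

lemma isometry_row:
  fixes u :: "'a \<Rightarrow> real" and a :: "'a \<Rightarrow> real ^ 'q"
  assumes st: "0 \<le> s" "s < t"
    and u: "u \<in> borel_measurable (F s)" "square_integrable M u"
    and a: "a \<in> borel_measurable (F s)" "square_integrable M a"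
  shows "integrable M (\<lambda>\<omega>. (u \<omega> + a \<omega> \<bullet> (W t \<omega> - W s \<omega>))\<^sup>2)"
    and "(\<integral>\<omega>. (u \<omega> + a \<omega> \<bullet> (W t \<omega> - W s \<omega>))\<^sup>2 \<partial>M)
      = (\<integral>\<omega>. (u \<omega>)\<^sup>2 \<partial>M) + (t - s) * (\<integral>\<omega>. (norm (a \<omega>))\<^sup>2 \<partial>M)"
proof -
  define \<Delta> where "\<Delta> \<omega> = W t \<omega> - W s \<omega>" for \<omega>
  note [measurable] = u(1) a(1)
  note mom = increment_moments[OF st, folded \<Delta>_def]
  have a_sq: "square_integrable M (\<lambda>\<omega>. a \<omega> $ i)" for i
    by (rule square_integrable_vec_nth[OF a(2)])
  have lin: "integrable M (\<lambda>\<omega>. (u \<omega> * a \<omega> $ i) * \<Delta> \<omega> $ i)"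
      "(\<integral>\<omega>. (u \<omega> * a \<omega> $ i) * \<Delta> \<omega> $ i \<partial>M) = 0" for i
    using past_times_increment[OF st, of "\<lambda>\<omega>. u \<omega> * a \<omega> $ i" "\<lambda>v. v $ i"]
      square_integrable_imp_integrable[OF mom(1)] integrable_mult_square_integrable[OF u(2) a_sq] mom(2)
    by (simp_all add: \<Delta>_def)
  \<comment> \<open>The product of four factors is integrable by independence: \<open>a\<close> is
    only square integrable, so the products of its coordinates are merely integrable, and so are
    those of the increment, but the two products are independent.\<close>
  have quad: "integrable M (\<lambda>\<omega>. (a \<omega> $ i * a \<omega> $ j) * (\<Delta> \<omega> $ i * \<Delta> \<omega> $ j))"
      "(\<integral>\<omega>. (a \<omega> $ i * a \<omega> $ j) * (\<Delta> \<omega> $ i * \<Delta> \<omega> $ j) \<partial>M)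
        = (if i = j then (t - s) * (\<integral>\<omega>. (a \<omega> $ i)\<^sup>2 \<partial>M) else 0)" for i j
    using past_times_increment[OF st, of "\<lambda>\<omega>. a \<omega> $ i * a \<omega> $ j" "\<lambda>v. v $ i * v $ j"]
      integrable_mult_square_integrable[OF mom(1) mom(1), of i j] integrable_mult_square_integrable[OF a_sq a_sq] mom(3)
    by (simp_all add: \<Delta>_def power2_eq_square)
  have expand: "(u \<omega> + a \<omega> \<bullet> \<Delta> \<omega>)\<^sup>2 = (u \<omega>)\<^sup>2 + 2 * (\<Sum>i\<in>UNIV. (u \<omega> * a \<omega> $ i) * \<Delta> \<omega> $ i)
      + (\<Sum>i\<in>UNIV. \<Sum>j\<in>UNIV. (a \<omega> $ i * a \<omega> $ j) * (\<Delta> \<omega> $ i * \<Delta> \<omega> $ j))" for \<omega>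
  proof -
    have "(a \<omega> \<bullet> \<Delta> \<omega>)\<^sup>2 = (\<Sum>i\<in>UNIV. \<Sum>j\<in>UNIV. (a \<omega> $ i * a \<omega> $ j) * (\<Delta> \<omega> $ i * \<Delta> \<omega> $ j))"
      by (simp add: inner_vec_def power2_eq_square sum_product mult_ac)
    moreover have "u \<omega> * (a \<omega> \<bullet> \<Delta> \<omega>) = (\<Sum>i\<in>UNIV. (u \<omega> * a \<omega> $ i) * \<Delta> \<omega> $ i)"
      by (simp add: inner_vec_def sum_distrib_left mult_ac)
    ultimately show ?thesis by (simp add: power2_sum)
  qed
  have u2: "integrable M (\<lambda>\<omega>. (u \<omega>)\<^sup>2)"
    using u(2) by (simp add: square_integrable_def)
  show "integrable M (\<lambda>\<omega>. (u \<omega> + a \<omega> \<bullet> (W t \<omega> - W s \<omega>))\<^sup>2)"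
    unfolding \<Delta>_def[symmetric] expand using u2 lin(1) quad(1) by simp
  have "(\<integral>\<omega>. (u \<omega> + a \<omega> \<bullet> \<Delta> \<omega>)\<^sup>2 \<partial>M)
      = (\<integral>\<omega>. (u \<omega>)\<^sup>2 \<partial>M) + (\<Sum>i\<in>UNIV. (t - s) * (\<integral>\<omega>. (a \<omega> $ i)\<^sup>2 \<partial>M))"
    unfolding expand using u2 lin quad by simp
  also have "(\<Sum>i\<in>UNIV. (t - s) * (\<integral>\<omega>. (a \<omega> $ i)\<^sup>2 \<partial>M)) = (t - s) * (\<integral>\<omega>. (norm (a \<omega>))\<^sup>2 \<partial>M)"
    using a_sq by (simp add: norm_vec_power2 sum_distrib_left square_integrable_def)
  finally show "(\<integral>\<omega>. (u \<omega> + a \<omega> \<bullet> (W t \<omega> - W s \<omega>))\<^sup>2 \<partial>M)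
      = (\<integral>\<omega>. (u \<omega>)\<^sup>2 \<partial>M) + (t - s) * (\<integral>\<omega>. (norm (a \<omega>))\<^sup>2 \<partial>M)"
    by (simp add: \<Delta>_def)
qed

text \<open>The squared norm of \<open>real ^ 'q ^ 'd\<close> is the sum of the squared norms of the
  rows, that is, the squared Hilbert-Schmidt norm. The isometry therefore follows by summation over
  the rows.\<close>

lemma isometry:
  fixes U :: "'a \<Rightarrow> real ^ 'd" and A :: "'a \<Rightarrow> real ^ 'q ^ 'd"
  assumes st: "0 \<le> s" "s < t"
    and U: "U \<in> borel_measurable (F s)" "square_integrable M U"
    and A: "A \<in> borel_measurable (F s)" "square_integrable M A"
  shows "square_integrable M (\<lambda>\<omega>. U \<omega> + A \<omega> *v (W t \<omega> - W s \<omega>))"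
    and "(\<integral>\<omega>. (norm (U \<omega> + A \<omega> *v (W t \<omega> - W s \<omega>)))\<^sup>2 \<partial>M)
      = (\<integral>\<omega>. (norm (U \<omega>))\<^sup>2 \<partial>M) + (t - s) * (\<integral>\<omega>. (norm (A \<omega>))\<^sup>2 \<partial>M)"
proof -
  note [measurable] = U(1) A(1)
  have [measurable]: "U \<in> borel_measurable M" "A \<in> borel_measurable M" "W s \<in> borel_measurable M" "W t \<in> borel_measurable M"
    using U A st measurable_W by (auto simp: square_integrable_def)
  have U_sq: "square_integrable M (\<lambda>\<omega>. U \<omega> $ i)" and A_sq: "square_integrable M (\<lambda>\<omega>. A \<omega> $ i)" for i
    by (rule square_integrable_vec_nth[OF U(2)] square_integrable_vec_nth[OF A(2)])+
  have U_meas: "(\<lambda>\<omega>. U \<omega> $ i) \<in> borel_measurable (F s)"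
    and A_meas: "(\<lambda>\<omega>. A \<omega> $ i) \<in> borel_measurable (F s)" for i
    by measurable
  have row: "integrable M (\<lambda>\<omega>. (U \<omega> $ i + A \<omega> $ i \<bullet> (W t \<omega> - W s \<omega>))\<^sup>2)"
    "(\<integral>\<omega>. (U \<omega> $ i + A \<omega> $ i \<bullet> (W t \<omega> - W s \<omega>))\<^sup>2 \<partial>M)
      = (\<integral>\<omega>. (U \<omega> $ i)\<^sup>2 \<partial>M) + (t - s) * (\<integral>\<omega>. (norm (A \<omega> $ i))\<^sup>2 \<partial>M)" for i
    by (rule isometry_row[OF st U_meas U_sq A_meas A_sq])+
  have expand: "(norm (U \<omega> + A \<omega> *v (W t \<omega> - W s \<omega>)))\<^sup>2
      = (\<Sum>i\<in>UNIV. (U \<omega> $ i + A \<omega> $ i \<bullet> (W t \<omega> - W s \<omega>))\<^sup>2)" for \<omega>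
    by (simp add: norm_vec_power2 matrix_vector_mul_component)
  have "(\<lambda>\<omega>. U \<omega> + A \<omega> *v (W t \<omega> - W s \<omega>)) \<in> borel_measurable M"
    by measurable
  then show "square_integrable M (\<lambda>\<omega>. U \<omega> + A \<omega> *v (W t \<omega> - W s \<omega>))"
    unfolding square_integrable_def expand using row(1) by (auto intro: integrable_sum)
  have "(\<integral>\<omega>. (norm (U \<omega> + A \<omega> *v (W t \<omega> - W s \<omega>)))\<^sup>2 \<partial>M)
      = (\<Sum>i\<in>UNIV. (\<integral>\<omega>. (U \<omega> $ i)\<^sup>2 \<partial>M)) + (t - s) * (\<Sum>i\<in>UNIV. (\<integral>\<omega>. (norm (A \<omega> $ i))\<^sup>2 \<partial>M))"
    unfolding expand by (simp add: row sum.distrib sum_distrib_left)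
  also have "(\<Sum>i\<in>UNIV. (\<integral>\<omega>. (U \<omega> $ i)\<^sup>2 \<partial>M)) = (\<integral>\<omega>. (norm (U \<omega>))\<^sup>2 \<partial>M)"
    using U_sq by (simp add: norm_vec_power2 square_integrable_def)
  also have "(\<Sum>i\<in>UNIV. (\<integral>\<omega>. (norm (A \<omega> $ i))\<^sup>2 \<partial>M)) = (\<integral>\<omega>. (norm (A \<omega>))\<^sup>2 \<partial>M)"
    unfolding norm_vec_power2[of "A _"] using A_sq by (subst Bochner_Integration.integral_sum) (auto simp: square_integrable_def)
  finally show "(\<integral>\<omega>. (norm (U \<omega> + A \<omega> *v (W t \<omega> - W s \<omega>)))\<^sup>2 \<partial>M)
      = (\<integral>\<omega>. (norm (U \<omega>))\<^sup>2 \<partial>M) + (t - s) * (\<integral>\<omega>. (norm (A \<omega>))\<^sup>2 \<partial>M)" .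
qed

text \<open>The factor in front of the old second moment must be 1 up to a multiple of the step
  length, since it is raised to the number of steps. Separating the noise by
  \<open>norm_add_power2_le\<close> would give the factor 2; the isometry separates it with factor
  1, and only the drift needs an inequality.\<close>

lemma mean_square_step:
  fixes U B V :: "'a \<Rightarrow> real ^ 'd" and A :: "'a \<Rightarrow> real ^ 'q ^ 'd"
  assumes st: "0 \<le> s" "s < t"
    and U: "U \<in> borel_measurable (F s)" "square_integrable M U"
    and B: "B \<in> borel_measurable (F s)" "square_integrable M B"
    and A: "A \<in> borel_measurable (F s)" "square_integrable M A"
    and V: "V \<in> borel_measurable M"
      "AE \<omega> in M. V \<omega> = U \<omega> + (t - s) *\<^sub>R B \<omega> + A \<omega> *v (W t \<omega> - W s \<omega>)"
  shows "square_integrable M V"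
    and "(\<integral>\<omega>. (norm (V \<omega>))\<^sup>2 \<partial>M) \<le> (1 + (t - s)) * (\<integral>\<omega>. (norm (U \<omega>))\<^sup>2 \<partial>M)
      + (t - s) * ((1 + (t - s)) * (\<integral>\<omega>. (norm (B \<omega>))\<^sup>2 \<partial>M) + (\<integral>\<omega>. (norm (A \<omega>))\<^sup>2 \<partial>M))"
proof -
  define h where "h = t - s"
  have h: "h > 0" using st by (simp add: h_def)
  let ?D = "\<lambda>\<omega>. U \<omega> + h *\<^sub>R B \<omega>"
  have D: "?D \<in> borel_measurable (F s)" "square_integrable M ?D"
    using U B by (auto intro: square_integrable_add square_integrable_scaleR)
  note iso = isometry[OF st D A]
  have VD: "AE \<omega> in M. V \<omega> = ?D \<omega> + A \<omega> *v (W t \<omega> - W s \<omega>)"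
    using V(2) by (simp add: h_def)
  show sqV: "square_integrable M V"
  proof (rule square_integrableI_bound[OF _ V(1)])
    show "integrable M (\<lambda>\<omega>. (norm (?D \<omega> + A \<omega> *v (W t \<omega> - W s \<omega>)))\<^sup>2)"
      using iso(1) by (simp add: square_integrable_def)
  qed (use VD in eventually_elim, simp)
  have "(\<integral>\<omega>. (norm (V \<omega>))\<^sup>2 \<partial>M) = (\<integral>\<omega>. (norm (?D \<omega> + A \<omega> *v (W t \<omega> - W s \<omega>)))\<^sup>2 \<partial>M)"
  proof (rule integral_cong_AE)
    show "AE \<omega> in M. (norm (V \<omega>))\<^sup>2 = (norm (?D \<omega> + A \<omega> *v (W t \<omega> - W s \<omega>)))\<^sup>2"
      using VD by eventually_elim simp
  qed (use iso(1) sqV in \<open>auto simp: square_integrable_def\<close>)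
  also have "\<dots> = (\<integral>\<omega>. (norm (?D \<omega>))\<^sup>2 \<partial>M) + h * (\<integral>\<omega>. (norm (A \<omega>))\<^sup>2 \<partial>M)"
    using iso(2) by (simp add: h_def)
  also have "(\<integral>\<omega>. (norm (?D \<omega>))\<^sup>2 \<partial>M)
      \<le> (\<integral>\<omega>. (1 + h) * (norm (U \<omega>))\<^sup>2 + (h + h\<^sup>2) * (norm (B \<omega>))\<^sup>2 \<partial>M)"
  proof (rule integral_mono)
    show "integrable M (\<lambda>\<omega>. (norm (?D \<omega>))\<^sup>2)"
      "integrable M (\<lambda>\<omega>. (1 + h) * (norm (U \<omega>))\<^sup>2 + (h + h\<^sup>2) * (norm (B \<omega>))\<^sup>2)"
      using D U B by (auto simp: square_integrable_def)
    fix \<omega>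
    have "(norm (?D \<omega>))\<^sup>2 \<le> (norm (U \<omega>) + h * norm (B \<omega>))\<^sup>2"
      using norm_triangle_ineq[of "U \<omega>" "h *\<^sub>R B \<omega>"] h by (intro power_mono) auto
    also have "\<dots> = (norm (U \<omega>))\<^sup>2 + h * (2 * norm (U \<omega>) * norm (B \<omega>)) + h\<^sup>2 * (norm (B \<omega>))\<^sup>2"
      by (simp add: power2_sum power_mult_distrib)
    \<comment> \<open>The mixed term already carries the factor \<open>h\<close>, so estimating it
      by a sum of squares costs only \<open>h\<close> times the old second moment.\<close>
    also have "\<dots> \<le> (norm (U \<omega>))\<^sup>2 + h * ((norm (U \<omega>))\<^sup>2 + (norm (B \<omega>))\<^sup>2) + h\<^sup>2 * (norm (B \<omega>))\<^sup>2"
      using sum_squares_bound[of "norm (U \<omega>)" "norm (B \<omega>)"] h by (intro add_mono mult_left_mono) auto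
    finally show "(norm (?D \<omega>))\<^sup>2 \<le> (1 + h) * (norm (U \<omega>))\<^sup>2 + (h + h\<^sup>2) * (norm (B \<omega>))\<^sup>2"
      by (simp add: algebra_simps)
  qed
  also have "\<dots> = (1 + h) * (\<integral>\<omega>. (norm (U \<omega>))\<^sup>2 \<partial>M) + (h + h\<^sup>2) * (\<integral>\<omega>. (norm (B \<omega>))\<^sup>2 \<partial>M)"
    using U B by (simp add: square_integrable_def)
  finally show "(\<integral>\<omega>. (norm (V \<omega>))\<^sup>2 \<partial>M) \<le> (1 + (t - s)) * (\<integral>\<omega>. (norm (U \<omega>))\<^sup>2 \<partial>M)
      + (t - s) * ((1 + (t - s)) * (\<integral>\<omega>. (norm (B \<omega>))\<^sup>2 \<partial>M) + (\<integral>\<omega>. (norm (A \<omega>))\<^sup>2 \<partial>M))"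
    by (simp add: h_def[symmetric] algebra_simps power2_eq_square)
qed

end

section \<open>The pathwise form of an Euler scheme on a cell of its grid\<close>

lemma grid_floor_eq:
  assumes "T > 0" and "n \<ge> 1" and "real p * (T / real n) \<le> s" and "s < real (Suc p) * (T / real n)"
  shows "grid_floor T n s = real p * (T / real n)"
proof -
  have "0 < T / real n" using assms by simp
  then have "\<lfloor>s / (T / real n)\<rfloor> = int p"
    using assms by (intro floor_unique) (simp_all only: pos_le_divide_eq pos_divide_less_eq of_int_of_nat_eq of_nat_Suc add.commute)
  then show ?thesis by (simp add: grid_floor_def)
qed

text \<open>The function factors through an integer, and every function on the integers is
  measurable for the counting space. This permits arbitrary \<open>c\<close>; it will be a
  coefficient along a path of the scheme, about whose measurability in time nothing is
  known.\<close>

lemma borel_measurable_grid_floor: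
  fixes c :: "real \<Rightarrow> 'b::topological_space"
  shows "(\<lambda>s. c (grid_floor T n s)) \<in> borel_measurable borel"
  unfolding grid_floor_def
  by (rule measurable_compose[of "\<lambda>s. \<lfloor>s / (T / real n)\<rfloor>" _ "count_space UNIV" "\<lambda>k. c (of_int k * (T / real n))"]) auto

lemma set_integral_grid_cell:
  fixes c :: "real \<Rightarrow> 'b::euclidean_space"
  assumes "T > 0" and "n \<ge> 1" and "real p * (T / real n) \<le> t" and "t \<le> real (Suc p) * (T / real n)"
  shows "set_integrable lborel {real p * (T / real n)..t} (\<lambda>s. c (grid_floor T n s))"
    and "(LBINT s:{real p * (T / real n)..t}. c (grid_floor T n s))
      = (t - real p * (T / real n)) *\<^sub>R c (real p * (T / real n))"
proof -
  let ?a = "real p * (T / real n)"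
  have [measurable]: "(\<lambda>s. c (grid_floor T n s)) \<in> borel_measurable lborel"
    using borel_measurable_grid_floor by simp
  \<comment> \<open>If \<open>t\<close> is the right end of the cell, \<open>grid_floor\<close>
    jumps there to the next grid point; a single point is a null set.\<close>
  have ae: "AE s\<in>{?a..t} in lborel. c (grid_floor T n s) = c ?a"
    using AE_lborel_singleton[of t]
  proof eventually_elim
    case (elim s)
    then show ?case
      using grid_floor_eq[OF assms(1,2), of p s] assms(4) by auto
  qed
  have "set_integrable lborel {?a..t} (\<lambda>s. c ?a)"
    unfolding set_integrable_def by (intro integrable_scaleR_left integrable_real_indicator) (auto simp: emeasure_lborel_Icc_eq)
  then show "set_integrable lborel {?a..t} (\<lambda>s. c (grid_floor T n s))"
    by (subst set_integrable_cong_AE[OF _ _ ae]) simp_all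
  have "(LBINT s:{?a..t}. c (grid_floor T n s)) = (LBINT s:{?a..t}. c ?a)"
    by (rule set_lebesgue_integral_cong_AE[OF _ _ _ ae]) simp_all
  also have "\<dots> = (t - ?a) *\<^sub>R c ?a"
    using assms(3) by (simp add: set_integral_const)
  finally show "(LBINT s:{?a..t}. c (grid_floor T n s)) = (t - ?a) *\<^sub>R c ?a" .
qed

text \<open>Integrability is carried through the induction because additivity over adjacent
  intervals requires it. With \<open>t\<close> arbitrary, the induction hypothesis can be used at
  the right end of the previous cell, where the remainder term is a full summand.\<close>

lemma set_integral_grid:
  fixes c :: "real \<Rightarrow> 'b::euclidean_space"
  assumes "T > 0" and "n \<ge> 1" and "real p * (T / real n) \<le> t" and "t \<le> real (Suc p) * (T / real n)"
  shows "set_integrable lborel {0..t} (\<lambda>s. c (grid_floor T n s)) \<and>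
    (LBINT s:{0..t}. c (grid_floor T n s))
      = (\<Sum>k<p. (T / real n) *\<^sub>R c (real k * (T / real n)))
        + (t - real p * (T / real n)) *\<^sub>R c (real p * (T / real n))"
  using assms(3,4)
proof (induction p arbitrary: t)
  case 0
  then show ?case using set_integral_grid_cell[OF assms(1,2), of 0 t c] by simp
next
  case (Suc p)
  define \<delta> where "\<delta> = T / real n"
  have "\<delta> > 0" using assms by (simp add: \<delta>_def)
  let ?a = "real (Suc p) * \<delta>"
  have IH: "set_integrable lborel {0..?a} (\<lambda>s. c (grid_floor T n s))"
    "(LBINT s:{0..?a}. c (grid_floor T n s)) = (\<Sum>k<Suc p. \<delta> *\<^sub>R c (real k * \<delta>))"
    using Suc.IH[of ?a] \<open>\<delta> > 0\<close> by (simp_all add: \<delta>_def[symmetric] algebra_simps)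
  have cell: "set_integrable lborel {?a..t} (\<lambda>s. c (grid_floor T n s))"
    "(LBINT s:{?a..t}. c (grid_floor T n s)) = (t - ?a) *\<^sub>R c ?a"
    using set_integral_grid_cell[OF assms(1,2) Suc.prems] by (simp_all only: \<delta>_def)
  have split: "{0..t} = {0..?a} \<union> {?a..t}"
    using Suc.prems(1) \<open>\<delta> > 0\<close> unfolding \<delta>_def[symmetric]
    by (subst ivl_disj_un_two_touch(4)) auto
  \<comment> \<open>The two closed intervals share only the point \<open>?a\<close>.\<close>
  have "AE s in lborel. \<not> (s \<in> {0..?a} \<and> s \<in> {?a..t})"
    using AE_lborel_singleton[of ?a] by eventually_elim auto
  from set_integral_Un_AE[OF this _ _ IH(1) cell(1)] set_integrable_Un[OF IH(1) cell(1)]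
  show ?case unfolding \<delta>_def[symmetric] split by (simp only: IH cell sets_lborel atLeastAtMost_borel simp_thms)
qed

lemma step_ito_integral_grid:
  assumes "\<delta> > 0" and "real p * \<delta> \<le> t" and "t \<le> real (Suc p) * \<delta>"
  shows "step_ito_integral \<delta> h w t
    = (\<Sum>k<p. h (real k * \<delta>) *v (w (real (Suc k) * \<delta>) - w (real k * \<delta>)))
      + h (real p * \<delta>) *v (w t - w (real p * \<delta>))"
proof -
  have "real (Suc k) * \<delta> \<le> t" if "k < p" for k
    using that assms mult_right_mono[of "real (Suc k)" "real p" \<delta>] by linarith
  then have below: "(\<Sum>k<p. h (real k * \<delta>) *v (w (min (real (Suc k) * \<delta>) t) - w (real k * \<delta>)))
      = (\<Sum>k<p. h (real k * \<delta>) *v (w (real (Suc k) * \<delta>) - w (real k * \<delta>)))"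
    by (intro sum.cong) (auto simp: min_def)
  show ?thesis
  proof (cases "t = real p * \<delta>")
    \<comment> \<open>At the left end of the cell the sum stops one index earlier; the last term of
      the claim vanishes there because its increment is zero.\<close>
    case True
    then have "nat \<lceil>t / \<delta>\<rceil> = p" using assms(1) by simp
    with below show ?thesis by (simp add: step_ito_integral_def True)
  next
    case False
    have "\<lceil>t / \<delta>\<rceil> = int (Suc p)"
    proof (rule ceiling_unique)
      show "of_int (int (Suc p)) - 1 < t / \<delta>"
        using assms False by (simp add: pos_less_divide_eq)
      show "t / \<delta> \<le> of_int (int (Suc p))"
        using assms by (simp only: pos_divide_le_eq of_int_of_nat_eq)
    qed
    then have "nat \<lceil>t / \<delta>\<rceil> = Suc p" by simp
    moreover have "min (real (Suc p) * \<delta>) t = t" using assms(3) by simp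
    ultimately show ?thesis
      unfolding step_ito_integral_def using below by (simp only: sum.lessThan_Suc)
  qed
qed

text \<open>Within one cell, the formulas for two times differ only in the last terms of the drift
  and of the noise. The time \<open>s\<close> may be any point of the cell, since points of a finer
  grid lie inside the cells of a coarse scheme while its coefficients stay frozen at the left end.
  The quantifiers stand inside the almost sure statement, so one null set serves all cells and
  times.\<close>

lemma euler_approximation_grid_cell:
  assumes "T > 0" and "n \<ge> 1" and "euler_approximation M F W b \<sigma> x T n X"
  shows "AE \<omega> in M. X 0 \<omega> = x"
    and "AE \<omega> in M. \<forall>p s t. real p * (T / real n) \<le> s \<longrightarrow> s \<le> t \<longrightarrow> t \<le> real (Suc p) * (T / real n) \<longrightarrow> t \<le> T \<longrightarrow>
      X t \<omega> = X s \<omega> + (t - s) *\<^sub>R b (X (real p * (T / real n)) \<omega>)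
        + \<sigma> (X (real p * (T / real n)) \<omega>) *v (W t \<omega> - W s \<omega>)"
proof -
  define \<delta> where "\<delta> = T / real n"
  have \<delta>: "\<delta> > 0" using assms by (simp add: \<delta>_def)
  have eq: "AE \<omega> in M. \<forall>t\<in>{0..T}. X t \<omega> = x + (LBINT s:{0..t}. b (X (grid_floor T n s) \<omega>))
      + step_ito_integral \<delta> (\<lambda>s. \<sigma> (X (grid_floor T n s) \<omega>)) (\<lambda>s. W s \<omega>) t"
    using assms(3) by (simp add: euler_approximation_def \<delta>_def)
  have on_grid: "grid_floor T n (real k * \<delta>) = real k * \<delta>" for k
    using grid_floor_eq[OF assms(1,2), of k "real k * \<delta>"] \<delta> by (simp add: \<delta>_def[symmetric])
  have formula: "AE \<omega> in M. \<forall>p t. real p * \<delta> \<le> t \<longrightarrow> t \<le> real (Suc p) * \<delta> \<longrightarrow> t \<le> T \<longrightarrow>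
      X t \<omega> = x + ((\<Sum>k<p. \<delta> *\<^sub>R b (X (real k * \<delta>) \<omega>)) + (t - real p * \<delta>) *\<^sub>R b (X (real p * \<delta>) \<omega>))
        + ((\<Sum>k<p. \<sigma> (X (real k * \<delta>) \<omega>) *v (W (real (Suc k) * \<delta>) \<omega> - W (real k * \<delta>) \<omega>))
          + \<sigma> (X (real p * \<delta>) \<omega>) *v (W t \<omega> - W (real p * \<delta>) \<omega>))"
    using eq
  proof (eventually_elim, intro allI impI)
    fix \<omega> p t
    assume X: "\<forall>t\<in>{0..T}. X t \<omega> = x + (LBINT s:{0..t}. b (X (grid_floor T n s) \<omega>))
        + step_ito_integral \<delta> (\<lambda>s. \<sigma> (X (grid_floor T n s) \<omega>)) (\<lambda>s. W s \<omega>) t"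
      and t: "real p * \<delta> \<le> t" "t \<le> real (Suc p) * \<delta>" "t \<le> T"
    have "0 \<le> real p * \<delta>" using \<delta> by simp
    then have "t \<in> {0..T}" using t by simp
    moreover have "(LBINT s:{0..t}. b (X (grid_floor T n s) \<omega>))
        = (\<Sum>k<p. \<delta> *\<^sub>R b (X (real k * \<delta>) \<omega>)) + (t - real p * \<delta>) *\<^sub>R b (X (real p * \<delta>) \<omega>)"
      using set_integral_grid[OF assms(1,2), of p t "\<lambda>s. b (X s \<omega>)"] t by (simp only: \<delta>_def)
    ultimately show "X t \<omega> = x + ((\<Sum>k<p. \<delta> *\<^sub>R b (X (real k * \<delta>) \<omega>)) + (t - real p * \<delta>) *\<^sub>R b (X (real p * \<delta>) \<omega>))
        + ((\<Sum>k<p. \<sigma> (X (real k * \<delta>) \<omega>) *v (W (real (Suc k) * \<delta>) \<omega> - W (real k * \<delta>) \<omega>))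
          + \<sigma> (X (real p * \<delta>) \<omega>) *v (W t \<omega> - W (real p * \<delta>) \<omega>))"
      using X step_ito_integral_grid[OF \<delta> t(1,2), of "\<lambda>s. \<sigma> (X (grid_floor T n s) \<omega>)" "\<lambda>s. W s \<omega>"]
      by (simp only: on_grid)
  qed
  from formula show "AE \<omega> in M. X 0 \<omega> = x"
  proof eventually_elim
    case (elim \<omega>)
    from elim[rule_format, of 0 0] \<delta> assms(1) show ?case by simp
  qed
  from formula show "AE \<omega> in M. \<forall>p s t. real p * (T / real n) \<le> s \<longrightarrow> s \<le> t \<longrightarrow> t \<le> real (Suc p) * (T / real n) \<longrightarrow> t \<le> T \<longrightarrow>
      X t \<omega> = X s \<omega> + (t - s) *\<^sub>R b (X (real p * (T / real n)) \<omega>)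
        + \<sigma> (X (real p * (T / real n)) \<omega>) *v (W t \<omega> - W s \<omega>)"
    unfolding \<delta>_def[symmetric]
  proof (eventually_elim, intro allI impI)
    fix \<omega> p s t
    assume X: "\<forall>p t. real p * \<delta> \<le> t \<longrightarrow> t \<le> real (Suc p) * \<delta> \<longrightarrow> t \<le> T \<longrightarrow>
        X t \<omega> = x + ((\<Sum>k<p. \<delta> *\<^sub>R b (X (real k * \<delta>) \<omega>)) + (t - real p * \<delta>) *\<^sub>R b (X (real p * \<delta>) \<omega>))
          + ((\<Sum>k<p. \<sigma> (X (real k * \<delta>) \<omega>) *v (W (real (Suc k) * \<delta>) \<omega> - W (real k * \<delta>) \<omega>))
            + \<sigma> (X (real p * \<delta>) \<omega>) *v (W t \<omega> - W (real p * \<delta>) \<omega>))"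
      and st: "real p * \<delta> \<le> s" "s \<le> t" "t \<le> real (Suc p) * \<delta>" "t \<le> T"
    then have "s \<le> real (Suc p) * \<delta>" "s \<le> T" "real p * \<delta> \<le> t" by linarith+
    note Xst = X[rule_format, OF st(1) this(1,2)] X[rule_format, OF this(3) st(3,4)]
    show "X t \<omega> = X s \<omega> + (t - s) *\<^sub>R b (X (real p * \<delta>) \<omega>) + \<sigma> (X (real p * \<delta>) \<omega>) *v (W t \<omega> - W s \<omega>)"
      unfolding Xst by (simp add: matrix_vector_mult_diff_distrib scaleR_diff_left)
  qed
qed

section \<open>Discrete Gronwall inequality and consequences of the Lipschitz condition\<close>

text \<open>Each factor \<open>1 + h * c\<close> is at most \<open>exp (h * c)\<close>, and each
  source term \<open>h * r\<close> may be enlarged by an exponential that is at least 1. The bound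
  depends on \<open>j\<close> and \<open>h\<close> only through the elapsed time
  \<open>real j * h\<close>, so it does not degrade under refinement.\<close>

lemma discrete_gronwall:
  fixes a :: "nat \<Rightarrow> real"
  assumes "0 \<le> h" "0 \<le> c" "0 \<le> r" "0 \<le> a 0"
    and step: "\<And>j. j < n \<Longrightarrow> a (Suc j) \<le> (1 + h * c) * a j + h * r"
  shows "j \<le> n \<Longrightarrow> a j \<le> exp (c * (real j * h)) * (a 0 + real j * h * r)"
proof (induction j)
  case (Suc j)
  let ?e = "exp (c * (real j * h))" and ?s = "a 0 + real j * h * r"
  have "a (Suc j) \<le> (1 + h * c) * a j + h * r" using Suc.prems by (intro step) simp
  also have "\<dots> \<le> (1 + h * c) * (?e * ?s) + h * r"
    using Suc assms by (intro add_right_mono mult_left_mono) auto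
  also have "\<dots> \<le> exp (h * c) * (?e * ?s) + exp (c * (real (Suc j) * h)) * (h * r)"
  proof (rule add_mono)
    show "(1 + h * c) * (?e * ?s) \<le> exp (h * c) * (?e * ?s)"
      using exp_ge_add_one_self[of "h * c"] assms by (intro mult_right_mono) auto
    have "1 \<le> exp (c * (real (Suc j) * h))" using assms by simp
    from mult_right_mono[OF this, of "h * r"] show "h * r \<le> exp (c * (real (Suc j) * h)) * (h * r)"
      using assms by simp
  qed
  also have "\<dots> = exp (c * (real (Suc j) * h)) * (a 0 + real (Suc j) * h * r)"
    by (simp add: algebra_simps exp_add)
  finally show ?case .
qed simp

lemma lipschitz_linear_growth:
  fixes g :: "'a::real_normed_vector \<Rightarrow> 'b::real_normed_vector"
  assumes "L-lipschitz_on UNIV g"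
  shows "(norm (g y))\<^sup>2 \<le> (2 * (norm (g 0))\<^sup>2 + 2 * L\<^sup>2) * (1 + (norm y)\<^sup>2)"
proof -
  have "norm (g y - g 0) \<le> L * norm y"
    using lipschitz_onD[OF assms, of y 0] by (simp add: dist_norm)
  then have "(norm (g y - g 0))\<^sup>2 \<le> L\<^sup>2 * (norm y)\<^sup>2"
    using power_mono[of _ _ 2] by (fastforce simp: power_mult_distrib)
  then have "(norm (g y))\<^sup>2 \<le> 2 * (norm (g 0))\<^sup>2 + 2 * (L\<^sup>2 * (norm y)\<^sup>2)"
    using norm_add_power2_le[of "g 0" "g y - g 0"] by simp
  \<comment> \<open>The nonnegative terms added here are those missing for the bound to factor into
    a constant times \<open>1 + (norm y)\<^sup>2\<close>.\<close>
  also have "\<dots> \<le> 2 * (norm (g 0))\<^sup>2 + 2 * (L\<^sup>2 * (norm y)\<^sup>2) + (2 * (norm (g 0))\<^sup>2 * (norm y)\<^sup>2 + 2 * L\<^sup>2)"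
    by simp
  finally show ?thesis by (simp add: algebra_simps)
qed

lemma lipschitz_norm_power2_diff:
  assumes "L-lipschitz_on UNIV g"
  shows "(norm (g y - g z))\<^sup>2 \<le> L\<^sup>2 * (norm (y - z))\<^sup>2"
  using power_mono[OF lipschitz_onD[OF assms, of y z], of 2] by (simp add: dist_norm power_mult_distrib)

lemma borel_measurable_lipschitz_on:
  assumes "L-lipschitz_on UNIV g"
  shows "g \<in> borel_measurable borel"
  using assms by (intro borel_measurable_continuous_onI lipschitz_on_continuous_on)

lemma square_integrable_lipschitz:
  fixes g :: "'b::{second_countable_topology, banach} \<Rightarrow> 'c::{second_countable_topology, banach}"
  assumes "finite_measure M" and "L-lipschitz_on UNIV g" and "square_integrable M U"
  shows "square_integrable M (\<lambda>\<omega>. g (U \<omega>))"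
proof (rule square_integrableI_bound)
  interpret finite_measure M by fact
  show "integrable M (\<lambda>\<omega>. (2 * (norm (g 0))\<^sup>2 + 2 * L\<^sup>2) * (1 + (norm (U \<omega>))\<^sup>2))"
    using assms(3) by (simp add: square_integrable_def)
  show "(\<lambda>\<omega>. g (U \<omega>)) \<in> borel_measurable M"
    using assms(3) borel_measurable_lipschitz_on[OF assms(2)]
    by (auto simp: square_integrable_def intro: measurable_compose)
qed (intro AE_I2 lipschitz_linear_growth[OF assms(2)])

section \<open>Moments and local errors of a single Euler scheme\<close>

text \<open>One constant \<open>C\<close> bounds drift and diffusion together, both for growth and
  for differences. All later constants are explicit in \<open>C\<close>, \<open>T\<close> and
  \<open>x\<close>, which makes their independence of the number of steps visible.\<close>

locale lipschitz_euler = brownian_motion M F W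
  for M :: "'a measure" and F :: "real \<Rightarrow> 'a measure" and W :: "real \<Rightarrow> 'a \<Rightarrow> real ^ 'q" +
  fixes b :: "real ^ 'd \<Rightarrow> real ^ 'd" and \<sigma> :: "real ^ 'd \<Rightarrow> real ^ 'q ^ 'd"
    and x :: "real ^ 'd" and T L\<^sub>b L\<^sub>\<sigma> C :: real
  assumes T_pos: "T > 0"
    and lip_b: "L\<^sub>b-lipschitz_on UNIV b" and lip_\<sigma>: "L\<^sub>\<sigma>-lipschitz_on UNIV \<sigma>"
    and growth: "(norm (b y))\<^sup>2 + (norm (\<sigma> y))\<^sup>2 \<le> C * (1 + (norm y)\<^sup>2)"
    and lip: "(norm (b y - b z))\<^sup>2 + (norm (\<sigma> y - \<sigma> z))\<^sup>2 \<le> C * (norm (y - z))\<^sup>2"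
begin

lemma C_nonneg: "0 \<le> C"
proof -
  have "0 \<le> (norm (b 0))\<^sup>2 + (norm (\<sigma> 0))\<^sup>2" by simp
  also have "\<dots> \<le> C" using growth[of 0] by simp
  finally show ?thesis .
qed

lemma measurable_coeffs:
  assumes "U \<in> borel_measurable N"
  shows "(\<lambda>\<omega>. b (U \<omega>)) \<in> borel_measurable N" "(\<lambda>\<omega>. \<sigma> (U \<omega>)) \<in> borel_measurable N"
  by (rule measurable_compose[OF assms borel_measurable_lipschitz_on[OF lip_b]]
      measurable_compose[OF assms borel_measurable_lipschitz_on[OF lip_\<sigma>]])+

lemma square_integrable_coeffs:
  assumes "square_integrable M U"
  shows "square_integrable M (\<lambda>\<omega>. b (U \<omega>))" "square_integrable M (\<lambda>\<omega>. \<sigma> (U \<omega>))"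
  by (rule square_integrable_lipschitz[OF finite_measure_axioms lip_b assms]
      square_integrable_lipschitz[OF finite_measure_axioms lip_\<sigma> assms])+

text \<open>All recursions below are instances of this form. The dominating function
  \<open>G\<close> comes from linear growth when the moments of one scheme are estimated, and from
  the Lipschitz bound when two schemes are compared.\<close>

lemma mean_square_step_le:
  fixes U B V :: "'a \<Rightarrow> real ^ 'd" and A :: "'a \<Rightarrow> real ^ 'q ^ 'd"
  assumes st: "0 \<le> s" "s < t" "t \<le> T"
    and U: "U \<in> borel_measurable (F s)" "square_integrable M U"
    and B: "B \<in> borel_measurable (F s)" "square_integrable M B"
    and A: "A \<in> borel_measurable (F s)" "square_integrable M A"
    and V: "V \<in> borel_measurable M"
      "AE \<omega> in M. V \<omega> = U \<omega> + (t - s) *\<^sub>R B \<omega> + A \<omega> *v (W t \<omega> - W s \<omega>)"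
    and G: "integrable M G" "\<And>\<omega>. (norm (B \<omega>))\<^sup>2 + (norm (A \<omega>))\<^sup>2 \<le> G \<omega>"
  shows "(\<integral>\<omega>. (norm (V \<omega>))\<^sup>2 \<partial>M) \<le> (1 + (t - s)) * (\<integral>\<omega>. (norm (U \<omega>))\<^sup>2 \<partial>M)
      + (t - s) * ((1 + T) * (\<integral>\<omega>. G \<omega> \<partial>M))"
proof -
  let ?\<beta> = "\<integral>\<omega>. (norm (B \<omega>))\<^sup>2 \<partial>M" and ?\<alpha> = "\<integral>\<omega>. (norm (A \<omega>))\<^sup>2 \<partial>M"
  have sq: "integrable M (\<lambda>\<omega>. (norm (B \<omega>))\<^sup>2)" "integrable M (\<lambda>\<omega>. (norm (A \<omega>))\<^sup>2)"
    using A B by (simp_all add: square_integrable_def)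
  have "?\<beta> + ?\<alpha> = (\<integral>\<omega>. (norm (B \<omega>))\<^sup>2 + (norm (A \<omega>))\<^sup>2 \<partial>M)"
    using sq by simp
  also have "\<dots> \<le> (\<integral>\<omega>. G \<omega> \<partial>M)"
    using sq G by (intro integral_mono) auto
  finally have le: "?\<beta> + ?\<alpha> \<le> (\<integral>\<omega>. G \<omega> \<partial>M)" .
  \<comment> \<open>Both weights are raised to \<open>1 + T\<close>, so that drift and noise enter
    only through the sum that \<open>G\<close> dominates.\<close>
  have "(1 + (t - s)) * ?\<beta> + ?\<alpha> \<le> (1 + T) * ?\<beta> + (1 + T) * ?\<alpha>"
    using st T_pos mult_right_mono[of 1 "1 + T" ?\<alpha>] by (intro add_mono mult_right_mono) auto
  also have "\<dots> \<le> (1 + T) * (\<integral>\<omega>. G \<omega> \<partial>M)"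
    using le T_pos by (simp add: distrib_left[symmetric])
  finally have "(t - s) * ((1 + (t - s)) * ?\<beta> + ?\<alpha>) \<le> (t - s) * ((1 + T) * (\<integral>\<omega>. G \<omega> \<partial>M))"
    using st by (intro mult_left_mono) auto
  with mean_square_step(2)[OF st(1,2) U B A V] show ?thesis by linarith
qed

text \<open>This is the Gronwall bound at time \<open>T\<close> with rate
  \<open>1 + (1 + T) * C\<close>, source \<open>(1 + T) * C\<close> and the deterministic initial
  value \<open>x\<close>.\<close>

definition moment_bound :: real where
  "moment_bound = exp ((1 + (1 + T) * C) * T) * ((norm x)\<^sup>2 + T * ((1 + T) * C))"

context
  fixes n :: nat and X :: "real \<Rightarrow> 'a \<Rightarrow> real ^ 'd"
  assumes n: "n \<ge> 1" and X: "euler_approximation M F W b \<sigma> x T n X"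
begin

lemma step_pos: "0 < T / real n"
  using n T_pos by simp

lemma euler_adapted: "0 \<le> t \<Longrightarrow> t \<le> T \<Longrightarrow> X t \<in> borel_measurable (F t)"
  using X by (simp add: euler_approximation_def)

lemma euler_measurable: "0 \<le> t \<Longrightarrow> t \<le> T \<Longrightarrow> X t \<in> borel_measurable M"
  using euler_adapted measurable_F_imp by blast

lemma grid_le_T: "p \<le> n \<Longrightarrow> real p * (T / real n) \<le> T"
  using n T_pos by (simp add: field_simps)

lemma euler_cell_AE:
  assumes "real p * (T / real n) \<le> s" "s \<le> t" "t \<le> real (Suc p) * (T / real n)" "t \<le> T"
  shows "AE \<omega> in M. X t \<omega> = X s \<omega> + (t - s) *\<^sub>R b (X (real p * (T / real n)) \<omega>)
        + \<sigma> (X (real p * (T / real n)) \<omega>) *v (W t \<omega> - W s \<omega>)"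
  using euler_approximation_grid_cell(2)[OF T_pos n X]
proof eventually_elim
  case (elim \<omega>)
  from elim[rule_format, OF assms] show ?case .
qed

lemma euler_start:
  shows "square_integrable M (X 0)" and "(\<integral>\<omega>. (norm (X 0 \<omega>))\<^sup>2 \<partial>M) = (norm x)\<^sup>2"
proof -
  have X0: "AE \<omega> in M. X 0 \<omega> = x" by (rule euler_approximation_grid_cell(1)[OF T_pos n X])
  have meas: "X 0 \<in> borel_measurable M" using euler_measurable[of 0] T_pos by simp
  show "square_integrable M (X 0)"
  proof (rule square_integrableI_bound[OF _ meas])
    show "integrable M (\<lambda>_. (norm x)\<^sup>2)" by simp
  qed (use X0 in eventually_elim, simp)
  have "(\<integral>\<omega>. (norm (X 0 \<omega>))\<^sup>2 \<partial>M) = (\<integral>\<omega>. (norm x)\<^sup>2 \<partial>M)"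
  proof (rule integral_cong_AE)
    show "AE \<omega> in M. (norm (X 0 \<omega>))\<^sup>2 = (norm x)\<^sup>2"
      using X0 by eventually_elim simp
  qed (use meas in measurable)
  then show "(\<integral>\<omega>. (norm (X 0 \<omega>))\<^sup>2 \<partial>M) = (norm x)\<^sup>2" by (simp add: prob_space)
qed

text \<open>Arbitrary times of a cell are covered because a coarse scheme is later evaluated on a
  finer grid. The left end is treated separately, since the step estimate requires a positive step
  length.\<close>

lemma euler_cell_square_integrable:
  assumes sq: "square_integrable M (X (real p * (T / real n)))"
    and t: "real p * (T / real n) \<le> t" "t \<le> real (Suc p) * (T / real n)" "t \<le> T"
  shows "square_integrable M (X t)"
proof (cases "t = real p * (T / real n)")
  case True
  with sq show ?thesis by simp
next
  case False
  let ?s = "real p * (T / real n)"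
  have s0: "0 \<le> ?s" using T_pos by simp
  have s: "?s < t" "?s \<le> T" using t False by linarith+
  note s = s0 s
  have "X t \<in> borel_measurable M" using s t by (intro euler_measurable) auto
  then show ?thesis
    using s t sq euler_adapted[OF s(1,3)]
    by (intro mean_square_step(1)[OF s(1,2) _ _ _ _ _ _ _ euler_cell_AE] measurable_coeffs square_integrable_coeffs) auto
qed

lemma euler_grid_square_integrable: "p \<le> n \<Longrightarrow> square_integrable M (X (real p * (T / real n)))"
proof (induction p)
  case 0
  then show ?case using euler_start(1) by simp
next
  case (Suc p)
  show ?case
  proof (rule euler_cell_square_integrable)
    show "square_integrable M (X (real p * (T / real n)))" using Suc by simp
    show "real p * (T / real n) \<le> real (Suc p) * (T / real n)"
      by (rule mult_right_mono[OF _ less_imp_le[OF step_pos]]) simp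
    show "real (Suc p) * (T / real n) \<le> T" using Suc by (intro grid_le_T)
  qed simp
qed

lemma euler_moment_le:
  assumes "p \<le> n"
  shows "(\<integral>\<omega>. (norm (X (real p * (T / real n)) \<omega>))\<^sup>2 \<partial>M) \<le> moment_bound"
proof -
  define h where "h = T / real n"
  have h: "h > 0" using step_pos by (simp add: h_def)
  define e where "e j = (\<integral>\<omega>. (norm (X (real j * h) \<omega>))\<^sup>2 \<partial>M)" for j
  have nonneg: "0 \<le> (1 + T) * C" using T_pos C_nonneg by simp
  \<comment> \<open>Linear growth bounds the coefficients by \<open>C * (1 + e j)\<close> in mean;
    the part with \<open>e j\<close> joins the rate and the rest is the source.\<close>
  have step: "e (Suc j) \<le> (1 + h * (1 + (1 + T) * C)) * e j + h * ((1 + T) * C)" if "j < n" for j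
  proof -
    let ?s = "real j * h" and ?t = "real (Suc j) * h"
    have t: "0 \<le> ?s" "?s < ?t" "?t \<le> T" "?s \<le> T"
      using h grid_le_T[of "Suc j"] grid_le_T[of j] that by (simp_all add: h_def[symmetric])
    have ts: "?t - ?s = h" by (simp add: algebra_simps)
    have sq: "square_integrable M (X ?s)"
      using euler_grid_square_integrable[of j] that by (simp add: h_def)
    have "AE \<omega> in M. X ?t \<omega> = X ?s \<omega> + (?t - ?s) *\<^sub>R b (X ?s \<omega>) + \<sigma> (X ?s \<omega>) *v (W ?t \<omega> - W ?s \<omega>)"
      using euler_cell_AE[of j ?s ?t] t by (simp only: h_def)
    from mean_square_step_le[OF t(1,2,3) euler_adapted[OF t(1,4)] sq
        measurable_coeffs(1)[OF euler_adapted[OF t(1,4)]] square_integrable_coeffs(1)[OF sq]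
        measurable_coeffs(2)[OF euler_adapted[OF t(1,4)]] square_integrable_coeffs(2)[OF sq]
        euler_measurable this _ growth] sq t
    have "e (Suc j) \<le> (1 + h) * e j + h * ((1 + T) * (\<integral>\<omega>. C * (1 + (norm (X ?s \<omega>))\<^sup>2) \<partial>M))"
      unfolding ts e_def by (simp add: square_integrable_def)
    also have "(\<integral>\<omega>. C * (1 + (norm (X ?s \<omega>))\<^sup>2) \<partial>M) = C * (1 + e j)"
      using sq by (simp add: square_integrable_def e_def prob_space)
    finally show ?thesis by (simp add: algebra_simps)
  qed
  have e0: "e 0 = (norm x)\<^sup>2" using euler_start(2) by (simp add: e_def)
  have "e p \<le> exp ((1 + (1 + T) * C) * (real p * h)) * (e 0 + real p * h * ((1 + T) * C))"
    using h nonneg e0 assms by (intro discrete_gronwall[where n = n] step) auto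
  also have "\<dots> \<le> exp ((1 + (1 + T) * C) * T) * ((norm x)\<^sup>2 + T * ((1 + T) * C))"
    unfolding e0 using nonneg grid_le_T[OF assms] h T_pos
    by (intro mult_mono add_left_mono mult_right_mono iffD2[OF exp_le_cancel_iff] mult_left_mono)
      (auto simp: h_def[symmetric])
  finally show ?thesis by (simp add: e_def h_def moment_bound_def)
qed

text \<open>The movement since the last grid point is itself a step that starts from 0, so only the
  source term of the step estimate remains. That term is proportional to the elapsed time, and the
  moment bound makes its coefficient uniform in \<open>n\<close>.\<close>

lemma euler_local_error:
  assumes p: "p < n" and t: "real p * (T / real n) \<le> t" "t \<le> real (Suc p) * (T / real n)"
  shows "(\<integral>\<omega>. (norm (X t \<omega> - X (real p * (T / real n)) \<omega>))\<^sup>2 \<partial>M)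
    \<le> T / real n * ((1 + T) * (C * (1 + moment_bound)))"
proof (cases "t = real p * (T / real n)")
  case True
  have "0 \<le> moment_bound"
    using T_pos C_nonneg by (simp add: moment_bound_def)
  with True T_pos C_nonneg show ?thesis by simp
next
  case False
  let ?s = "real p * (T / real n)"
  have s0: "0 \<le> ?s" using T_pos by simp
  have "real (Suc p) * (T / real n) = ?s + T / real n"
    by (simp only: of_nat_Suc distrib_right mult_1 add.commute)
  with t False grid_le_T[of "Suc p"] p
  have s: "?s < t" "?s \<le> T" "t \<le> T" and ts: "0 \<le> t - ?s" "t - ?s \<le> T / real n"
    by linarith+
  note s = s0 s
  have sq: "square_integrable M (X ?s)"
    using euler_grid_square_integrable[of p] p by simp
  \<comment> \<open>The summand \<open>0\<close> is the starting value \<open>U\<close> of the step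
    estimate.\<close>
  have AE: "AE \<omega> in M. X t \<omega> - X ?s \<omega> = 0 + (t - ?s) *\<^sub>R b (X ?s \<omega>) + \<sigma> (X ?s \<omega>) *v (W t \<omega> - W ?s \<omega>)"
    using euler_cell_AE[of p ?s t] t s by (auto elim!: eventually_mono)
  have "(\<lambda>\<omega>. X t \<omega> - X ?s \<omega>) \<in> borel_measurable M"
    using s by (intro borel_measurable_diff euler_measurable) auto
  from mean_square_step_le[OF s(1,2,4) _ square_integrable_const
      measurable_coeffs(1)[OF euler_adapted[OF s(1,3)]] square_integrable_coeffs(1)[OF sq]
      measurable_coeffs(2)[OF euler_adapted[OF s(1,3)]] square_integrable_coeffs(2)[OF sq]
      this AE _ growth] sq
  have "(\<integral>\<omega>. (norm (X t \<omega> - X ?s \<omega>))\<^sup>2 \<partial>M)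
      \<le> (t - ?s) * ((1 + T) * (\<integral>\<omega>. C * (1 + (norm (X ?s \<omega>))\<^sup>2) \<partial>M))"
    by (simp add: square_integrable_def)
  also have "(\<integral>\<omega>. C * (1 + (norm (X ?s \<omega>))\<^sup>2) \<partial>M) = C * (1 + (\<integral>\<omega>. (norm (X ?s \<omega>))\<^sup>2 \<partial>M))"
    using sq by (simp add: square_integrable_def prob_space)
  also have "(t - ?s) * ((1 + T) * (C * (1 + (\<integral>\<omega>. (norm (X ?s \<omega>))\<^sup>2 \<partial>M))))
      \<le> T / real n * ((1 + T) * (C * (1 + moment_bound)))"
    using ts euler_moment_le[of p] p T_pos C_nonneg
    by (intro mult_mono) (auto intro!: mult_nonneg_nonneg add_nonneg_nonneg integral_nonneg)
  finally show ?thesis .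
qed

end

section \<open>The mean square distance between a scheme and its refinement\<close>

text \<open>This is the Gronwall bound for initial error 0 over time \<open>T\<close>, with the
  local error bound as source and with its factor \<open>1 / real n\<close> removed. Each factor 2
  comes from splitting a difference of two positions in two.\<close>

definition strong_error_constant :: real where
  "strong_error_constant =
     exp ((1 + 2 * ((1 + T) * C)) * T) * (T * (2 * ((1 + T) * C) * (T * ((1 + T) * (C * (1 + moment_bound))))))"

text \<open>Every cell of the grid with \<open>n * k\<close> steps lies in one cell of the grid with
  \<open>n\<close> steps, so on it both schemes obey a one-step equation with the same increment of
  \<open>W\<close>. It is essential that the bound is free of \<open>k\<close>.\<close>

lemma strong_error_refinement:
  assumes n: "n \<ge> 1" and k: "k \<ge> 1"
    and Y: "euler_approximation M F W b \<sigma> x T n Y"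
    and Z: "euler_approximation M F W b \<sigma> x T (n * k) Z"
  shows "square_integrable M (Y T)" and "square_integrable M (Z T)"
    and "(\<integral>\<omega>. (norm (Z T \<omega> - Y T \<omega>))\<^sup>2 \<partial>M) \<le> strong_error_constant / real n"
proof -
  have nk: "n * k \<ge> 1" using n k by simp
  define h where "h = T / real (n * k)"
  have h: "h > 0" using n k T_pos by (simp add: h_def)
  have \<delta>: "T / real n = real k * h" using n k by (simp add: h_def)
  have end_pt: "real (n * k) * h = T" using n k by (simp add: h_def)
  have le_T: "real j * h \<le> T" if "j \<le> n * k" for j
  proof -
    have "real j \<le> real (n * k)" using that by (simp only: of_nat_le_iff)
    from mult_right_mono[OF this less_imp_le[OF h]] show ?thesis unfolding end_pt .
  qed
  \<comment> \<open>The fine cell with index \<open>j\<close> lies in the coarse cell with index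
    \<open>j div k\<close>.\<close>
  have cell: "j div k < n" "real (j div k) * (real k * h) \<le> real j * h"
      "real (Suc j) * h \<le> real (Suc (j div k)) * (real k * h)" if "j < n * k" for j
  proof -
    show "j div k < n" using that k by (simp add: div_less_iff_less_mult)
    have "real (j div k * k) \<le> real j" by (subst of_nat_le_iff) simp
    from mult_right_mono[OF this, of h] h show "real (j div k) * (real k * h) \<le> real j * h"
      by (simp add: mult.assoc)
    have "Suc j \<le> Suc (j div k) * k"
      using k dividend_less_div_times[of k j] by simp
    then have "real (Suc j) \<le> real (Suc (j div k) * k)" by (subst of_nat_le_iff)
    from mult_right_mono[OF this, of h] h show "real (Suc j) * h \<le> real (Suc (j div k)) * (real k * h)"
      by (simp only: of_nat_mult mult.assoc)
  qed
  have sqZ: "square_integrable M (Z (real j * h))" if "j \<le> n * k" for j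
    using euler_grid_square_integrable[OF nk Z that] by (simp only: h_def)
  have sqYgrid: "square_integrable M (Y (real p * (real k * h)))" if "p \<le> n" for p
    using euler_grid_square_integrable[OF n Y that] by (simp only: \<delta>)
  \<comment> \<open>Here \<open>Y\<close> is evaluated between its own grid points. The strict bound
    on \<open>j\<close> ensures that \<open>j div k\<close> is the index of a cell; the final time
    is a grid point of \<open>Y\<close> and is treated below.\<close>
  have sqY: "square_integrable M (Y (real j * h))" if "j < n * k" for j
  proof -
    have "real j * h \<le> real (Suc (j div k)) * (real k * h)"
      using cell(3)[OF that] h by (simp add: algebra_simps)
    then show ?thesis
      using euler_cell_square_integrable[OF n Y, of "j div k" "real j * h"] sqYgrid[of "j div k"] cell[OF that]
        le_T[of j] that unfolding \<delta> by simp
  qed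
  show sqYT: "square_integrable M (Y T)"
    using sqYgrid[of n] end_pt by (simp add: mult.assoc)
  show "square_integrable M (Z T)"
    using sqZ[of "n * k"] end_pt by simp
  define D where "D = T * ((1 + T) * (C * (1 + moment_bound)))"
  have D: "0 \<le> D" and nonneg: "0 \<le> (1 + T) * C"
    using T_pos C_nonneg by (simp_all add: D_def moment_bound_def)
  define e where "e j = (\<integral>\<omega>. (norm (Z (real j * h) \<omega> - Y (real j * h) \<omega>))\<^sup>2 \<partial>M)" for j
  define c where "c = 1 + 2 * ((1 + T) * C)"
  define r where "r = 2 * ((1 + T) * C) * (D / real n)"
  have step: "e (Suc j) \<le> (1 + h * c) * e j + h * r" if j: "j < n * k" for j
  proof -
    \<comment> \<open>The time \<open>?u\<close> is the coarse grid point at which the coefficients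
      of \<open>Y\<close> are frozen on this fine cell.\<close>
    let ?s = "real j * h" and ?t = "real (Suc j) * h" and ?u = "real (j div k) * (real k * h)"
    have t: "0 \<le> ?s" "?s < ?t" "?t \<le> T" "?s \<le> T"
      using h le_T[of "Suc j"] le_T[of j] j by simp_all
    have u0: "0 \<le> ?u" using h by simp
    have u: "0 \<le> ?u" "?u \<le> ?s" "?u \<le> T"
      using u0 cell(2)[OF j] order_trans[OF cell(2)[OF j] t(4)] by blast+
    have ts: "?t - ?s = h" by (simp add: algebra_simps)
    have sq: "square_integrable M (Z ?s)" "square_integrable M (Y ?s)" "square_integrable M (Y ?u)"
      using sqZ[of j] sqY[of j] sqYgrid[of "j div k"] cell(1)[OF j] j by simp_all
    have meas: "Z ?s \<in> borel_measurable (F ?s)" "Y ?s \<in> borel_measurable (F ?s)" "Y ?u \<in> borel_measurable (F ?s)"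
      using euler_adapted[OF nk Z] euler_adapted[OF n Y] t u by (auto intro: measurable_F_mono[OF u(1,2)])
    let ?U = "\<lambda>\<omega>. Z ?s \<omega> - Y ?s \<omega>" and ?V = "\<lambda>\<omega>. Z ?t \<omega> - Y ?t \<omega>"
      and ?B = "\<lambda>\<omega>. b (Z ?s \<omega>) - b (Y ?u \<omega>)" and ?A = "\<lambda>\<omega>. \<sigma> (Z ?s \<omega>) - \<sigma> (Y ?u \<omega>)"
    \<comment> \<open>The coefficients are compared at \<open>Z ?s\<close> and \<open>Y ?u\<close>.
      Inserting \<open>Y ?s\<close> splits this distance into the current error and the movement of
      \<open>Y\<close> since \<open>?u\<close>.\<close>
    let ?G = "\<lambda>\<omega>. C * (2 * (norm (?U \<omega>))\<^sup>2 + 2 * (norm (Y ?s \<omega> - Y ?u \<omega>))\<^sup>2)"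
    have "AE \<omega> in M. Z ?t \<omega> = Z ?s \<omega> + (?t - ?s) *\<^sub>R b (Z ?s \<omega>) + \<sigma> (Z ?s \<omega>) *v (W ?t \<omega> - W ?s \<omega>)"
      using euler_cell_AE[OF nk Z, of j ?s ?t] t by (simp only: h_def)
    moreover have "AE \<omega> in M. Y ?t \<omega> = Y ?s \<omega> + (?t - ?s) *\<^sub>R b (Y ?u \<omega>) + \<sigma> (Y ?u \<omega>) *v (W ?t \<omega> - W ?s \<omega>)"
      using euler_cell_AE[OF n Y, of "j div k" ?s ?t] t cell(2,3)[OF j] unfolding \<delta> by simp
    ultimately have AE: "AE \<omega> in M. ?V \<omega> = ?U \<omega> + (?t - ?s) *\<^sub>R ?B \<omega> + ?A \<omega> *v (W ?t \<omega> - W ?s \<omega>)"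
    proof eventually_elim
      case (elim \<omega>)
      show ?case unfolding elim by (simp add: matrix_vector_mult_diff_rdistrib scaleR_diff_right)
    qed
    have U: "?U \<in> borel_measurable (F ?s)" "square_integrable M ?U"
      using meas sq by (auto intro: square_integrable_diff)
    have B: "?B \<in> borel_measurable (F ?s)" "square_integrable M ?B"
      using measurable_coeffs(1) square_integrable_coeffs(1) meas sq
      by (auto intro!: square_integrable_diff borel_measurable_diff)
    have A: "?A \<in> borel_measurable (F ?s)" "square_integrable M ?A"
      using measurable_coeffs(2) square_integrable_coeffs(2) meas sq
      by (auto intro!: square_integrable_diff borel_measurable_diff)
    have V: "?V \<in> borel_measurable M"
      using t euler_measurable[OF nk Z, of ?t] euler_measurable[OF n Y, of ?t] by (intro borel_measurable_diff) auto
    have local: "square_integrable M (\<lambda>\<omega>. Y ?s \<omega> - Y ?u \<omega>)"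
      using sq by (intro square_integrable_diff)
    have G: "integrable M ?G"
      using U local by (simp add: square_integrable_def)
    have "(norm (?B \<omega>))\<^sup>2 + (norm (?A \<omega>))\<^sup>2 \<le> ?G \<omega>" for \<omega>
    proof -
      have "(norm (?B \<omega>))\<^sup>2 + (norm (?A \<omega>))\<^sup>2 \<le> C * (norm (Z ?s \<omega> - Y ?u \<omega>))\<^sup>2" by (rule lip)
      also have "\<dots> \<le> ?G \<omega>"
        using norm_add_power2_le[of "?U \<omega>" "Y ?s \<omega> - Y ?u \<omega>"] C_nonneg by (intro mult_left_mono) auto
      finally show ?thesis .
    qed
    from mean_square_step_le[OF t(1,2,3) U B A V AE G this]
    have "e (Suc j) \<le> (1 + h) * e j + h * ((1 + T) * (\<integral>\<omega>. ?G \<omega> \<partial>M))"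
      unfolding ts e_def .
    also have "(\<integral>\<omega>. ?G \<omega> \<partial>M) = C * (2 * e j + 2 * (\<integral>\<omega>. (norm (Y ?s \<omega> - Y ?u \<omega>))\<^sup>2 \<partial>M))"
      using U local by (simp add: square_integrable_def e_def)
    also have "h * ((1 + T) * \<dots>) \<le> h * ((1 + T) * (C * (2 * e j + 2 * (D / real n))))"
    proof -
      \<comment> \<open>This places \<open>?s\<close> in the coarse cell that starts at
        \<open>?u\<close>, as the local error bound for \<open>Y\<close> requires.\<close>
      have "?s \<le> real (Suc (j div k)) * (T / real n)"
        using t(2) cell(3)[OF j] unfolding \<delta> by linarith
      with euler_local_error[OF n Y cell(1)[OF j], of ?s] u(2)
      have "(\<integral>\<omega>. (norm (Y ?s \<omega> - Y ?u \<omega>))\<^sup>2 \<partial>M) \<le> D / real n"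
        unfolding D_def \<delta>[symmetric] by simp
      then show ?thesis
        using h T_pos C_nonneg by (intro mult_left_mono) auto
    qed
    finally show ?thesis by (simp add: c_def r_def algebra_simps add_divide_distrib)
  qed
  \<comment> \<open>Both schemes start at \<open>x\<close> almost surely, so only the accumulated
    source remains in the Gronwall bound.\<close>
  have e0: "e 0 = 0"
  proof -
    have "AE \<omega> in M. (norm (Z 0 \<omega> - Y 0 \<omega>))\<^sup>2 = 0"
      using euler_approximation_grid_cell(1)[OF T_pos n Y] euler_approximation_grid_cell(1)[OF T_pos nk Z]
      by eventually_elim simp
    then show ?thesis unfolding e_def by (simp add: integral_eq_zero_AE)
  qed
  have "e (n * k) \<le> exp (c * (real (n * k) * h)) * (e 0 + real (n * k) * h * r)"
    using h nonneg e0 D by (intro discrete_gronwall[where n = "n * k"] step) (auto simp: c_def r_def)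
  also have "\<dots> = strong_error_constant / real n"
    unfolding end_pt e0 c_def r_def strong_error_constant_def D_def by simp
  finally show "(\<integral>\<omega>. (norm (Z T \<omega> - Y T \<omega>))\<^sup>2 \<partial>M) \<le> strong_error_constant / real n"
    unfolding e_def end_pt .
qed

end

section \<open>From the strong error to the variance\<close>

text \<open>The mean minimises the second moment: expanding about the mean, the mixed term
  integrates to zero and the square of its distance to \<open>a\<close> is left over.\<close>

lemma (in prob_space) variance_vector_le:
  fixes Q :: "'a \<Rightarrow> 'b::euclidean_space"
  assumes "square_integrable M Q"
  shows "integrable M (\<lambda>\<omega>. (norm (Q \<omega> - (\<integral>\<omega>'. Q \<omega>' \<partial>M)))\<^sup>2)"
    and "(\<integral>\<omega>. (norm (Q \<omega> - (\<integral>\<omega>'. Q \<omega>' \<partial>M)))\<^sup>2 \<partial>M) \<le> (\<integral>\<omega>. (norm (Q \<omega> - a))\<^sup>2 \<partial>M)"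
proof -
  define \<mu> where "\<mu> = (\<integral>\<omega>. Q \<omega> \<partial>M)"
  have sq: "square_integrable M (\<lambda>\<omega>. Q \<omega> - y)" for y
    using assms by (intro square_integrable_diff square_integrable_const)
  then show "integrable M (\<lambda>\<omega>. (norm (Q \<omega> - (\<integral>\<omega>'. Q \<omega>' \<partial>M)))\<^sup>2)"
    by (simp add: square_integrable_def)
  have Q: "integrable M Q" using assms by (rule square_integrable_imp_integrable)
  have "(norm (Q \<omega> - a))\<^sup>2 = (norm (Q \<omega> - \<mu>))\<^sup>2 + 2 * ((Q \<omega> - \<mu>) \<bullet> (\<mu> - a)) + (norm (\<mu> - a))\<^sup>2" for \<omega>
    by (simp add: power2_norm_eq_inner inner_simps inner_commute)
  then have "(\<integral>\<omega>. (norm (Q \<omega> - a))\<^sup>2 \<partial>M) = (\<integral>\<omega>. (norm (Q \<omega> - \<mu>))\<^sup>2 \<partial>M) + (norm (\<mu> - a))\<^sup>2"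
    using sq[of \<mu>] Q by (simp add: square_integrable_def prob_space \<mu>_def[symmetric])
  then show "(\<integral>\<omega>. (norm (Q \<omega> - (\<integral>\<omega>'. Q \<omega>' \<partial>M)))\<^sup>2 \<partial>M) \<le> (\<integral>\<omega>. (norm (Q \<omega> - a))\<^sup>2 \<partial>M)"
    by (simp add: \<mu>_def)
qed

theorem proposition3p1:
  fixes M :: "'a measure"
    and F :: "real \<Rightarrow> 'a measure"
    and W :: "real \<Rightarrow> 'a \<Rightarrow> real ^ 'q"
    and b :: "real ^ 'd \<Rightarrow> real ^ 'd"
    and \<sigma> :: "real ^ 'd \<Rightarrow> real ^ 'q ^ 'd"
    and x :: "real ^ 'd"
    and T :: real
    and X :: "nat \<Rightarrow> real \<Rightarrow> 'a \<Rightarrow> real ^ 'd"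
    and f :: "real ^ 'd \<Rightarrow> real ^ 'd"
  assumes "T > 0"
    and "brownian_motion M F W"
    and "\<And>t. t \<ge> 0 \<Longrightarrow> sets (F t) = sets (brownian_filtration M W t)"
    and "continuously_differentiable b" and "\<exists>L. L-lipschitz_on UNIV b"
    and "continuously_differentiable \<sigma>" and "\<exists>L. L-lipschitz_on UNIV \<sigma>"
    and "\<And>n. n \<ge> 1 \<Longrightarrow> euler_approximation M F W b \<sigma> x T n (X n)"
    and "\<exists>L. L-lipschitz_on UNIV f"
  shows "\<exists>K::real. \<forall>m n. 1 \<le> m \<and> m \<le> n \<longrightarrow>
    (let M\<^sub>m = (\<integral>\<omega>. f (X m T \<omega>) \<partial>M);
         Q = (\<lambda>\<omega>. f (X n T \<omega>) - f (X m T \<omega>) + M\<^sub>m)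
     in integrable M (\<lambda>\<omega>. f (X m T \<omega>)) \<and>
        integrable M (\<lambda>\<omega>. (norm (Q \<omega> - (\<integral>\<omega>'. Q \<omega>' \<partial>M)))\<^sup>2) \<and>
        Var M Q \<le> K / real m)"
proof -
  obtain L\<^sub>b L\<^sub>\<sigma> L\<^sub>f where lips: "L\<^sub>b-lipschitz_on UNIV b" "L\<^sub>\<sigma>-lipschitz_on UNIV \<sigma>" "L\<^sub>f-lipschitz_on UNIV f"
    using assms by blast
  \<comment> \<open>The sum of the two growth constants also dominates
    \<open>L\<^sub>b\<^sup>2 + L\<^sub>\<sigma>\<^sup>2\<close>, so it serves for differences as
    well.\<close>
  define C where "C = (2 * (norm (b 0))\<^sup>2 + 2 * L\<^sub>b\<^sup>2) + (2 * (norm (\<sigma> 0))\<^sup>2 + 2 * L\<^sub>\<sigma>\<^sup>2)"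
  interpret brownian_motion M F W by fact
  interpret lipschitz_euler M F W b \<sigma> x T L\<^sub>b L\<^sub>\<sigma> C
  proof unfold_locales
    show "(norm (b y))\<^sup>2 + (norm (\<sigma> y))\<^sup>2 \<le> C * (1 + (norm y)\<^sup>2)" for y
      using add_mono[OF lipschitz_linear_growth[OF lips(1), of y] lipschitz_linear_growth[OF lips(2), of y]]
      by (simp only: C_def distrib_right)
    show "(norm (b y - b z))\<^sup>2 + (norm (\<sigma> y - \<sigma> z))\<^sup>2 \<le> C * (norm (y - z))\<^sup>2" for y z
    proof -
      have "(norm (b y - b z))\<^sup>2 + (norm (\<sigma> y - \<sigma> z))\<^sup>2 \<le> (L\<^sub>b\<^sup>2 + L\<^sub>\<sigma>\<^sup>2) * (norm (y - z))\<^sup>2"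
        unfolding distrib_right by (intro add_mono lipschitz_norm_power2_diff lips)
      also have "\<dots> \<le> C * (norm (y - z))\<^sup>2"
        by (intro mult_right_mono) (simp_all add: C_def)
      finally show ?thesis .
    qed
  qed (use assms lips in auto)
  define S where "S = strong_error_constant"
  show ?thesis
    unfolding Let_def
  \<comment> \<open>Splitting at the refined scheme costs a factor 2, and each of the two resulting
    errors is at most \<open>S / real m\<close>.\<close>
  proof (intro exI[of _ "4 * L\<^sub>f\<^sup>2 * S"] allI impI, elim conjE, intro conjI)
    fix m n :: nat
    assume m: "1 \<le> m" and mn: "m \<le> n"
    then have n: "1 \<le> n" and nm: "1 \<le> n * m" by simp_all
    \<comment> \<open>The same process refines the scheme of \<open>m\<close> steps by the factor
      \<open>n\<close> and that of \<open>n\<close> steps by the factor \<open>m\<close>.\<close>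
    have "euler_approximation M F W b \<sigma> x T (m * n) (X (n * m))"
      using assms(8)[OF nm] by (simp add: mult.commute)
    note err_m = strong_error_refinement[OF m n assms(8)[OF m] this, folded S_def]
    note err_n = strong_error_refinement[OF n m assms(8)[OF n] assms(8)[OF nm], folded S_def]
    have sq_f: "square_integrable M (\<lambda>\<omega>. f (X k T \<omega>))" if "square_integrable M (X k T)" for k
      by (rule square_integrable_lipschitz[OF finite_measure_axioms lips(3) that])
    define a where "a = (\<integral>\<omega>. f (X m T \<omega>) \<partial>M)"
    define Q where "Q = (\<lambda>\<omega>. f (X n T \<omega>) - f (X m T \<omega>) + a)"
    have Q: "square_integrable M Q"
      unfolding Q_def using sq_f[OF err_n(1)] sq_f[OF err_m(1)]
      by (intro square_integrable_add square_integrable_diff square_integrable_const)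
    show "integrable M (\<lambda>\<omega>. f (X m T \<omega>))"
      by (rule square_integrable_imp_integrable[OF sq_f[OF err_m(1)]])
    show "integrable M (\<lambda>\<omega>. (norm (f (X n T \<omega>) - f (X m T \<omega>) + (\<integral>\<omega>. f (X m T \<omega>) \<partial>M)
        - (\<integral>\<omega>'. f (X n T \<omega>') - f (X m T \<omega>') + (\<integral>\<omega>. f (X m T \<omega>) \<partial>M) \<partial>M)))\<^sup>2)"
      using variance_vector_le(1)[OF Q] unfolding Q_def a_def .
    let ?Z = "X (n * m) T"
    \<comment> \<open>The sign of \<open>S\<close> is read off from the error bound; it is used to
      weaken \<open>S / real n\<close> to \<open>S / real m\<close>.\<close>
    have "0 \<le> (\<integral>\<omega>. (norm (?Z \<omega> - X m T \<omega>))\<^sup>2 \<partial>M)" by simp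
    also have "\<dots> \<le> S / real m" by (rule err_m(3))
    finally have S: "0 \<le> S" using m by (simp add: zero_le_divide_iff)
    have sq_diff: "integrable M (\<lambda>\<omega>. (norm (?Z \<omega> - X m T \<omega>))\<^sup>2)" "integrable M (\<lambda>\<omega>. (norm (?Z \<omega> - X n T \<omega>))\<^sup>2)"
      using square_integrable_diff[OF err_m(2,1)] square_integrable_diff[OF err_n(2,1)]
      by (simp_all add: square_integrable_def)
    \<comment> \<open>With the centre \<open>a\<close>, the added constant cancels and only the
      difference of the two values of \<open>f\<close> is left.\<close>
    have "Var M Q \<le> (\<integral>\<omega>. (norm (Q \<omega> - a))\<^sup>2 \<partial>M)"
      unfolding Var_def by (rule variance_vector_le(2)[OF Q])
    also have "\<dots> \<le> (\<integral>\<omega>. L\<^sub>f\<^sup>2 * (2 * (norm (?Z \<omega> - X m T \<omega>))\<^sup>2 + 2 * (norm (?Z \<omega> - X n T \<omega>))\<^sup>2) \<partial>M)"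
    proof (rule integral_mono)
      show "integrable M (\<lambda>\<omega>. (norm (Q \<omega> - a))\<^sup>2)"
        using square_integrable_diff[OF Q square_integrable_const] by (simp add: square_integrable_def)
      show "integrable M (\<lambda>\<omega>. L\<^sub>f\<^sup>2 * (2 * (norm (?Z \<omega> - X m T \<omega>))\<^sup>2 + 2 * (norm (?Z \<omega> - X n T \<omega>))\<^sup>2))"
        using sq_diff by simp
      fix \<omega>
      have "(norm (Q \<omega> - a))\<^sup>2 \<le> L\<^sub>f\<^sup>2 * (norm (X n T \<omega> - X m T \<omega>))\<^sup>2"
        unfolding Q_def by (simp add: lipschitz_norm_power2_diff[OF lips(3)])
      also have "(norm (X n T \<omega> - X m T \<omega>))\<^sup>2 \<le> 2 * (norm (?Z \<omega> - X m T \<omega>))\<^sup>2 + 2 * (norm (?Z \<omega> - X n T \<omega>))\<^sup>2"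
        using norm_add_power2_le[of "?Z \<omega> - X m T \<omega>" "X n T \<omega> - ?Z \<omega>"]
        by (simp add: norm_minus_commute[of "X n T \<omega>" "?Z \<omega>"])
      finally show "(norm (Q \<omega> - a))\<^sup>2
          \<le> L\<^sub>f\<^sup>2 * (2 * (norm (?Z \<omega> - X m T \<omega>))\<^sup>2 + 2 * (norm (?Z \<omega> - X n T \<omega>))\<^sup>2)"
        by (simp add: mult_left_mono)
    qed
    also have "\<dots> = L\<^sub>f\<^sup>2 * (2 * (\<integral>\<omega>. (norm (?Z \<omega> - X m T \<omega>))\<^sup>2 \<partial>M) + 2 * (\<integral>\<omega>. (norm (?Z \<omega> - X n T \<omega>))\<^sup>2 \<partial>M))"
      using sq_diff by simp
    also have "\<dots> \<le> L\<^sub>f\<^sup>2 * (2 * (S / real m) + 2 * (S / real m))"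
    proof -
      have "S / real n \<le> S / real m" using S m mn by (intro divide_left_mono) auto
      with err_n(3) err_m(3) show ?thesis by (intro mult_left_mono add_mono) auto
    qed
    also have "\<dots> = 4 * L\<^sub>f\<^sup>2 * S / real m" by simp
    finally show "Var M (\<lambda>\<omega>. f (X n T \<omega>) - f (X m T \<omega>) + (\<integral>\<omega>. f (X m T \<omega>) \<partial>M)) \<le> 4 * L\<^sub>f\<^sup>2 * S / real m"
      unfolding Q_def a_def .
  qed
qed

end
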